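(* Let $d \ge 1$ and $\varepsilon > 0$. (a) $\mathbb{P}\big(|R_n - \mathbb{E} R_n| \ge (\ln n)^{3d/4 + \varepsilon} \text{ infinitely often}\big) = 0$; consequently $R_n / \mathbb{E} R_n \to 1$ almost surely. (b) $\mathbb{P}\big(|\beta_n - \mathbb{E} \beta_n| \ge (\ln n)^{3d/4 + \varepsilon} \text{ infinitely often}\big) = 0$; consequently $\beta_n / \mathbb{E} \beta_n \to 1$ almost surely. (c) $\mathbb{P}\big(|r_n - \mathbb{E} r_n| \ge (\ln n)^{3d/4 + \varepsilon} \text{ infinitely often}\big) = 0$; consequently, if $d \ge 5$, then $r_n / \mathbb{E} r_n \to 1$ almost surely.
   Context: Fix an integer $d \ge 1$. Let $X^{(1)}, X^{(2)}, \dots$ be i.i.d. random vectors in $\mathbb{R}^d$ with independent Exponential$(1)$ coordinates. Write $x \prec y$ if $x_j<y_j$ for all $j$. $X^{(k)}$ is a (Pareto) record if $X^{(k)} \not\prec X^{(i)}$ for all $1 \le i < k$; for $1 \le k \le n$, $X^{(k)}$ is a current record at time $n$ if $X^{(k)} \not\prec X^{(i)}$ for all $1 \le i \le n$. $R_n$ is the number of records among $X^{(1)},\dots,X^{(n)}$, $r_n$ is the number of current records at time $n$, and $\beta_n := R_n - r_n$ is the number of broken records at time $n$. *)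

theory Defs
  imports "HOL-Probability.Probability"
begin

text \<open>Vectors in R^d are represented as functions nat => real; only coordinates j < d matter.
  x \<prec> y iff x_j < y_j for all j < d.\<close>
definition strictly_dominated :: "nat \<Rightarrow> (nat \<Rightarrow> real) \<Rightarrow> (nat \<Rightarrow> real) \<Rightarrow> bool" where
  "strictly_dominated d x y \<longleftrightarrow> (\<forall>j<d. x j < y j)"

text \<open>Observations are X 1, X 2, ... (1-indexed). R_n: number of records among X 1..X n.\<close>
definition num_records :: "nat \<Rightarrow> (nat \<Rightarrow> nat \<Rightarrow> real) \<Rightarrow> nat \<Rightarrow> nat" where
  "num_records d X n = card {k \<in> {1..n}. \<forall>i\<in>{1..<k}. \<not> strictly_dominated d (X k) (X i)}"

definition num_current_records :: "nat \<Rightarrow> (nat \<Rightarrow> nat \<Rightarrow> real) \<Rightarrow> nat \<Rightarrow> nat" where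
  "num_current_records d X n = card {k \<in> {1..n}. \<forall>i\<in>{1..n}. \<not> strictly_dominated d (X k) (X i)}"

definition num_broken_records :: "nat \<Rightarrow> (nat \<Rightarrow> nat \<Rightarrow> real) \<Rightarrow> nat \<Rightarrow> real" where
  "num_broken_records d X n = real (num_records d X n) - real (num_current_records d X n)"

end

theory Submission
  imports Defs
begin

text \<open>
  The numbers R_n of records and \<open>\<beta>\<close>_n of broken records are nondecreasing in n, and their means grow
  like \<open>(ln n)^d\<close>. Once both variances are known to be \<open>O((ln n)^d)\<close>, Chebyshev's inequality and the
  Borel--Cantelli lemma along times of order \<open>exp (j powr (2 / d))\<close>, combined with monotonicity between
  these times, give the deviation bounds for R_n and \<open>\<beta>\<close>_n, and by subtraction the one for r_n.

  Write D(x) for the probability that an observation dominates x; its law is that of a product of d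
  uniform variables, and the probability that the (m+1)-st observation is a record is
  \<open>E (1 - D)^m\<close>, which satisfies a recursion in d and m. The covariances of record indicators are
  bounded by moments of the form \<open>E [D(x \<or> y) / D(y) (1 - D(x))^m (1 - D(y))^m]\<close> for two independent
  observations x and y. These are \<open>O((ln m)^(d-1) / m\<^sup>2)\<close>: the bound \<open>(1 - D)^m \<le> (m D) powr (-3/2)\<close>
  makes the integrand a product over the coordinates of x, and integrating x out leaves
  \<open>E [(1 - D)^m D powr (-1/2)]\<close>, which again satisfies a recursion in d and m.
\<close>

section \<open>Iterated means\<close>

text \<open>Three exponents shape the proof. The 3/2 in the bound on \<open>(1 - D)^m\<close> lies
  strictly between 1 and 2: with 1 each coordinate integral over x would cost an extra logarithm,
  with 2 it would diverge at 0. What it leaves behind, \<open>D(y) powr (-1/2)\<close>, is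
  integrable, and the half moment supplies the missing \<open>m powr (-1/2)\<close> to reach
  \<open>m powr (-2)\<close>. The 3d/4 comes from Chebyshev: at times where \<open>(ln n)^d\<close>
  is about \<open>j^2\<close>, a threshold h fails with probability about \<open>j^2 / h^2\<close>,
  summable once \<open>h = j powr (3/2 + \<delta>)\<close>, and j is about
  \<open>ln n powr (d/2)\<close>. The mean grows only by O(j) on a block, which is below h. The
  restriction d >= 5 for the ratio of r_n comes from its mean, of order \<open>(ln n)^(d-1)\<close>:
  3d/4 < d - 1 means d > 4. Since r_n is not monotone, the sandwich between two times fails for it,
  which is why it is reached through the two monotone counts.\<close>

fun iter_mean :: "nat \<Rightarrow> nat \<Rightarrow> real" where
  "iter_mean 0 m = 0 ^ m"
| "iter_mean (Suc d) m = (\<Sum>i\<le>m. iter_mean d i) / (real m + 1)"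

lemma iter_mean_nonneg: "0 \<le> iter_mean d m"
  by (induction d m rule: iter_mean.induct) (auto intro!: sum_nonneg divide_nonneg_nonneg)

lemma inverse_le_ln_diff:
  fixes k :: nat
  assumes "k \<ge> 1"
  shows "1 / (real k + 1) \<le> ln (real k + 1) - ln (real k)"
proof -
  have "ln (real k / (real k + 1)) \<le> real k / (real k + 1) - 1"
    using assms by (intro ln_le_minus_one) auto
  also have "\<dots> = - (1 / (real k + 1))"
    by (simp add: field_simps)
  finally show ?thesis using assms by (simp add: ln_div)
qed

lemma ln_diff_le_inverse:
  fixes k :: nat
  assumes "k \<ge> 1"
  shows "ln (real k + 1) - ln (real k) \<le> 1 / real k"
proof -
  have "ln ((real k + 1) / real k) \<le> (real k + 1) / real k - 1"
    using assms by (intro ln_le_minus_one) auto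
  also have "\<dots> = 1 / real k"
    using assms by (simp add: field_simps)
  finally show ?thesis using assms by (simp add: ln_div)
qed

lemma sum_inverse_le_ln: "(\<Sum>i<n. 1 / (real i + 1)) \<le> 1 + ln (real n)" if "n \<ge> 1"
  using that
proof (induction n rule: dec_induct)
  case base
  then show ?case by simp
next
  case (step n)
  have "(\<Sum>i<Suc n. 1 / (real i + 1)) \<le> 1 + ln (real n) + 1 / (real n + 1)"
    using step by simp
  also have "\<dots> \<le> 1 + ln (real (Suc n))"
    using inverse_le_ln_diff[of n] step by (simp add: add.commute)
  finally show ?case .
qed

text \<open>\<open>iter_mean d m\<close> is the moment \<open>E (1 - D)^m\<close>, see
  \<open>nn_integral_dom_prob_power\<close>. Averaging the bound over i <= m costs one harmonic sum,
  so each dimension adds one logarithm.\<close>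

lemma iter_mean_upper: "iter_mean (Suc d) m \<le> (1 + ln (real m + 1)) ^ d / (real m + 1)"
proof (induction d arbitrary: m)
  case 0
  have "(\<Sum>i\<le>m. (0::real) ^ i) = 1"
    by (simp add: power_0_left sum.delta)
  then show ?case by simp
next
  case (Suc d)
  have "(\<Sum>i\<le>m. iter_mean (Suc d) i) \<le> (\<Sum>i\<le>m. (1 + ln (real m + 1)) ^ d * (1 / (real i + 1)))"
  proof (intro sum_mono)
    fix i assume "i \<in> {..m}"
    then have "(1 + ln (real i + 1)) ^ d \<le> (1 + ln (real m + 1)) ^ d"
      by (intro power_mono) auto
    then have "(1 + ln (real i + 1)) ^ d / (real i + 1) \<le> (1 + ln (real m + 1)) ^ d / (real i + 1)"
      by (intro divide_right_mono) auto
    with Suc[of i] show "iter_mean (Suc d) i \<le> (1 + ln (real m + 1)) ^ d * (1 / (real i + 1))"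
      by simp
  qed
  also have "\<dots> = (1 + ln (real m + 1)) ^ d * (\<Sum>i<Suc m. 1 / (real i + 1))"
    by (simp add: sum_distrib_left lessThan_Suc_atMost)
  also have "\<dots> \<le> (1 + ln (real m + 1)) ^ d * (1 + ln (real (Suc m)))"
    by (intro mult_left_mono sum_inverse_le_ln) auto
  also have "\<dots> = (1 + ln (real m + 1)) ^ Suc d"
    by (simp add: add.commute)
  finally show ?case
    unfolding iter_mean.simps(2)[of "Suc d"] by (intro divide_right_mono) auto
qed

text \<open>The mean value bound for powers: each of the d + 1 summands in the factorization of
  \<open>y ^ Suc d - x ^ Suc d\<close> is at most \<open>y ^ d\<close>.\<close>

lemma power_diff_le_deriv:
  fixes x y :: real
  assumes "0 \<le> x" "x \<le> y"
  shows "y ^ Suc d - x ^ Suc d \<le> (y - x) * (real (Suc d) * y ^ d)"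
proof -
  have "(\<Sum>i<Suc d. y ^ i * x ^ (d - i)) \<le> (\<Sum>i<Suc d. y ^ d)"
  proof (intro sum_mono)
    fix i assume "i \<in> {..<Suc d}"
    then have "y ^ i * x ^ (d - i) \<le> y ^ i * y ^ (d - i)" "i \<le> d"
      using assms by (auto intro!: mult_left_mono power_mono)
    then show "y ^ i * x ^ (d - i) \<le> y ^ d"
      by (simp flip: power_add)
  qed
  then have "(y - x) * (\<Sum>i<Suc d. y ^ i * x ^ (d - i)) \<le> (y - x) * (real (Suc d) * y ^ d)"
    using assms by (intro mult_left_mono) auto
  also have "(y - x) * (\<Sum>i<Suc d. y ^ i * x ^ (d - i)) = y ^ Suc d - x ^ Suc d"
    by (simp only: power_diff_sumr2[of y "Suc d" x]) (simp add: mult.commute)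
  finally show ?thesis .
qed

text \<open>Follows from \<open>x * x ^ d \<le> x * y ^ d\<close>. It later turns the growth of a
  mean over a block of times into a difference of d-th powers.\<close>

lemma power_diff_ge:
  fixes x y :: real
  assumes "0 \<le> x" "x \<le> y"
  shows "(y - x) * y ^ d \<le> y ^ Suc d - x ^ Suc d"
  using mult_right_mono[OF power_mono[OF assms(2,1), of d] assms(1)] by (simp add: algebra_simps)

text \<open>By induction, the average defining \<open>iter_mean (Suc d) i\<close> is at least the
  increment of \<open>ln ^ Suc d / fact (Suc d)\<close> from i + 1 to i + 2, and these increments
  telescope. The sum is the mean number of records among n observations.\<close>

lemma sum_iter_mean_lower:
  assumes "n \<ge> 1"
  shows "ln (real n + 1) ^ d / fact d \<le> (\<Sum>i<n. iter_mean d i)"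
  using assms
proof (induction d arbitrary: n)
  case 0
  then show ?case by (cases n) (auto simp: power_0_left sum.delta)
next
  case (Suc d)
  have *: "(ln (real i + 2) ^ Suc d - ln (real i + 1) ^ Suc d) / fact (Suc d) \<le> iter_mean (Suc d) i" for i
  proof -
    have "ln (real i + 2) ^ Suc d - ln (real i + 1) ^ Suc d
        \<le> (ln (real i + 2) - ln (real i + 1)) * (real (Suc d) * ln (real i + 2) ^ d)"
      by (intro power_diff_le_deriv) auto
    also have "\<dots> \<le> 1 / (real i + 1) * (real (Suc d) * ln (real i + 2) ^ d)"
      using ln_diff_le_inverse[of "Suc i"] by (intro mult_right_mono) (auto simp: add.commute)
    finally have "(ln (real i + 2) ^ Suc d - ln (real i + 1) ^ Suc d) / fact (Suc d)
        \<le> 1 / (real i + 1) * (real (Suc d) * ln (real i + 2) ^ d) / fact (Suc d)"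
      by (intro divide_right_mono) auto
    also have "\<dots> = (ln (real (Suc i) + 1) ^ d / fact d) / (real i + 1)"
      by (simp add: fact_Suc mult.commute del: of_nat_Suc) (simp add: add.commute)
    also have "\<dots> \<le> (\<Sum>j<Suc i. iter_mean d j) / (real i + 1)"
      by (intro divide_right_mono Suc.IH) auto
    finally show ?thesis by (simp add: lessThan_Suc_atMost)
  qed
  have "ln (real n + 1) ^ Suc d / fact (Suc d)
      = (\<Sum>i<n. ln (real (Suc i) + 1) ^ Suc d - ln (real i + 1) ^ Suc d) / fact (Suc d)"
    by (subst sum_lessThan_telescope[where f = "\<lambda>i. ln (real i + 1) ^ Suc d"]) simp
  also have "\<dots> = (\<Sum>i<n. (ln (real i + 2) ^ Suc d - ln (real i + 1) ^ Suc d) / fact (Suc d))"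
    by (simp add: sum_divide_distrib add.commute)
  also have "\<dots> \<le> (\<Sum>i<n. iter_mean (Suc d) i)"
    by (intro sum_mono *)
  finally show ?case .
qed

text \<open>Each new term carries a factor 1 / (m + 1), at most the increment of the logarithm;
  replacing the logarithmic factor by its final value only enlarges the bound.\<close>

lemma sum_iter_mean_incr:
  assumes "1 \<le> n" "n \<le> n'"
  shows "(\<Sum>i<n'. iter_mean (Suc d) i) - (\<Sum>i<n. iter_mean (Suc d) i)
     \<le> (1 + ln (real n')) ^ d * (ln (real n') - ln (real n))"
  using assms(2,1)
proof (induction n' rule: dec_induct)
  case base
  then show ?case by simp
next
  case (step m)
  have m: "m \<ge> 1" using step by simp
  have "(\<Sum>i<Suc m. iter_mean (Suc d) i) - (\<Sum>i<n. iter_mean (Suc d) i)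
     \<le> (1 + ln (real m)) ^ d * (ln (real m) - ln (real n)) + iter_mean (Suc d) m"
    using step by simp
  also have "(1 + ln (real m)) ^ d * (ln (real m) - ln (real n))
      \<le> (1 + ln (real m + 1)) ^ d * (ln (real m) - ln (real n))"
    using step m by (intro mult_right_mono power_mono) auto
  also have "iter_mean (Suc d) m \<le> (1 + ln (real m + 1)) ^ d * (1 / (real m + 1))"
    using iter_mean_upper[of d m] by simp
  also have "\<dots> \<le> (1 + ln (real m + 1)) ^ d * (ln (real m + 1) - ln (real m))"
    by (intro mult_left_mono inverse_le_ln_diff m) auto
  finally show ?case by (simp add: algebra_simps)
qed

lemma sum_iter_mean_upper:
  assumes "n \<ge> 1"
  shows "(\<Sum>i<n. iter_mean d i) \<le> (1 + ln (real n)) ^ d"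
proof -
  obtain m where n: "n = Suc m" using assms by (cases n) auto
  have "(\<Sum>i<n. iter_mean d i) = (real m + 1) * iter_mean (Suc d) m"
    by (simp add: n lessThan_Suc_atMost)
  also have "\<dots> \<le> (1 + ln (real m + 1)) ^ d"
    using iter_mean_upper[of d m] by (simp add: field_simps)
  finally show ?thesis by (simp add: n add.commute)
qed

section \<open>Integrals against the exponential law\<close>

definition expo :: "real measure" where
  "expo = density lborel (\<lambda>x. ennreal (exponential_density 1 x))"

text \<open>The survival function of the exponential law; under that law it is itself uniform on [0, 1].\<close>
definition surv :: "real \<Rightarrow> real" where
  "surv x = min 1 (exp (- x))"

definition expo_vec :: "nat \<Rightarrow> (nat \<Rightarrow> real) measure" where
  "expo_vec d = PiM {..<d} (\<lambda>_. expo)"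

definition dom_prob :: "nat \<Rightarrow> (nat \<Rightarrow> real) \<Rightarrow> real" where
  "dom_prob d x = (\<Prod>j<d. surv (x j))"

text \<open>The probability that one observation dominates both x and y.\<close>
definition dom_prob2 :: "nat \<Rightarrow> (nat \<Rightarrow> real) \<Rightarrow> (nat \<Rightarrow> real) \<Rightarrow> real" where
  "dom_prob2 d x y = (\<Prod>j<d. min (surv (x j)) (surv (y j)))"

lemma surv_pos: "0 < surv x" and surv_le_1: "surv x \<le> 1"
  by (auto simp: surv_def)

lemma surv_nonneg: "0 \<le> surv x"
  using surv_pos[of x] by simp

lemma measurable_surv [measurable]: "surv \<in> borel_measurable borel"
  unfolding surv_def by measurable

lemma dom_prob_pos: "0 < dom_prob d x" and dom_prob_le_1: "dom_prob d x \<le> 1"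
  unfolding dom_prob_def by (auto intro!: prod_pos prod_le_1 simp: surv_pos surv_le_1 less_imp_le)

lemma dom_prob2_nonneg: "0 \<le> dom_prob2 d x y"
  unfolding dom_prob2_def by (auto intro!: prod_nonneg simp: surv_pos less_imp_le)

lemma dom_prob2_le: "dom_prob2 d x y \<le> dom_prob d x" "dom_prob2 d x y \<le> dom_prob d y"
  unfolding dom_prob2_def dom_prob_def by (auto intro!: prod_mono simp: surv_pos less_imp_le)

text \<open>Dominating x and dominating y are positively correlated, since u v <= min u v for u and
  v in [0, 1].\<close>

lemma dom_prob_mult_le: "dom_prob d x * dom_prob d y \<le> dom_prob2 d x y"
  unfolding dom_prob2_def dom_prob_def prod.distrib[symmetric]
  by (intro prod_mono) (auto simp: surv_nonneg surv_le_1 intro!: mult_left_le mult_left_le_one_le)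

lemma prob_space_expo: "prob_space expo"
  unfolding expo_def by (rule prob_space_exponential_density) simp

lemma sets_expo [measurable_cong]: "sets expo = sets borel"
  and space_expo [simp]: "space expo = UNIV"
  by (auto simp: expo_def)

lemma prob_space_expo_vec: "prob_space (expo_vec d)"
  unfolding expo_vec_def by (intro prob_space_PiM prob_space_expo)

lemma sets_expo_vec [measurable_cong]: "sets (expo_vec d) = sets (PiM {..<d} (\<lambda>_. borel))"
  unfolding expo_vec_def by (intro sets_PiM_cong) (auto simp: sets_expo)

lemma measurable_dom_prob [measurable]: "dom_prob d \<in> borel_measurable (expo_vec d)"
  unfolding dom_prob_def[abs_def] by measurable

lemma measurable_expo_vec_component:
  assumes "j < d" "f \<in> measurable N (expo_vec d)"
  shows "(\<lambda>z. f z j) \<in> borel_measurable N"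
proof -
  have "(\<lambda>x. x j) \<in> measurable (expo_vec d) expo"
    unfolding expo_vec_def using assms by (intro measurable_component_singleton) auto
  from measurable_compose[OF assms(2) this] show ?thesis
    by (simp add: measurable_cong_sets[OF refl sets_expo])
qed

lemma measurable_dom_prob2 [measurable (raw)]:
  assumes "f \<in> measurable N (expo_vec d)" "g \<in> measurable N (expo_vec d)"
  shows "(\<lambda>z. dom_prob2 d (f z) (g z)) \<in> borel_measurable N"
  unfolding dom_prob2_def
  by (intro borel_measurable_prod borel_measurable_min)
    (auto intro!: measurable_compose[OF _ measurable_surv] measurable_expo_vec_component[OF _ assms(1)]
      measurable_expo_vec_component[OF _ assms(2)])

lemma measure_expo_greaterThan: "measure expo {x<..} = surv x"
proof -
  interpret prob_space expo by (rule prob_space_expo)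
  have D: "distributed expo lborel (\<lambda>x. x) (exponential_density 1)"
    unfolding distributed_def expo_def by (auto simp: distr_id2)
  show ?thesis
  proof (cases "0 \<le> x")
    case True
    then show ?thesis using exponential_distributedD_gt[OF D True]
      by (simp add: surv_def greaterThan_def)
  next
    case False
    have "measure expo {0<..} = 1"
      using exponential_distributedD_gt[OF D, of 0] by (simp add: greaterThan_def)
    moreover have "measure expo {0<..} \<le> measure expo {x<..}"
      using False by (intro finite_measure_mono) auto
    ultimately have "measure expo {x<..} = 1"
      using prob_le_1[of "{x<..}"] by linarith
    with False show ?thesis by (simp add: surv_def)
  qed
qed

text \<open>Changes an exponential coordinate into a uniform one, so that all later integrals are
  over [0, 1]. The law of \<open>surv\<close> is identified by its distribution function.\<close>

lemma nn_integral_surv: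
  assumes [measurable]: "f \<in> borel_measurable borel"
  shows "(\<integral>\<^sup>+ x. f (surv x) \<partial>expo) = (\<integral>\<^sup>+ u. f u * indicator {0..1} u \<partial>lborel)"
proof -
  interpret prob_space expo by (rule prob_space_expo)
  have AE: "AE x in expo. x \<noteq> a" for a
    unfolding expo_def using AE_lborel_singleton[of a] by (subst AE_density) auto
  have "distributed expo lborel surv (\<lambda>x. indicator {0..1} x / measure lborel {0..1::real})"
  proof (rule uniform_distrI_borel_atLeastAtMost)
    fix t :: real assume t: "0 \<le> t" "t \<le> 1"
    show "measure expo {x \<in> space expo. surv x \<le> t} = (t - 0) / (1 - 0)"
    \<comment> \<open>The endpoints are separate: \<open>- ln 0\<close> is no meaningful threshold,
      and \<open>surv x \<le> 1\<close> also holds for x <= 0.\<close>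
    proof (cases "t = 0 \<or> t = 1")
      case True
      have "{x. surv x \<le> 0} = {}" "{x. surv x \<le> 1} = UNIV"
        using surv_pos surv_le_1 by (auto simp: not_le)
      with True show ?thesis using prob_space by auto
    next
      case False
      with t have t: "0 < t" "t < 1" by auto
      \<comment> \<open>The two events differ only at the point \<open>- ln t\<close>, which is a
        null set.\<close>
      have "measure expo {x \<in> space expo. surv x \<le> t} = measure expo {- ln t<..}"
      proof (rule measure_eq_AE)
        have *: "surv x \<le> t \<longleftrightarrow> x > - ln t" if "x \<noteq> - ln t" for x
        proof -
          have "surv x \<le> t \<longleftrightarrow> exp (- x) \<le> exp (ln t)" using t by (auto simp: surv_def)
          also have "\<dots> \<longleftrightarrow> x > - ln t" using that by (subst exp_le_cancel_iff) auto
          finally show ?thesis .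
        qed
        show "AE x in expo. x \<in> {x \<in> space expo. surv x \<le> t} \<longleftrightarrow> x \<in> {- ln t<..}"
          using AE[of "- ln t"] by eventually_elim (simp add: *)
      qed auto
      also have "\<dots> = t"
        using t by (simp add: measure_expo_greaterThan surv_def)
      finally show ?thesis by simp
    qed
  qed (auto simp: measurable_surv)
  from distributed_nn_integral[OF this, of f] show ?thesis
    by (simp add: mult.commute[of "f _"] ennreal_indicator)
qed

interpretation expo_prod: product_sigma_finite "\<lambda>_::nat. expo"
  by (intro product_sigma_finite.intro prob_space_imp_sigma_finite prob_space_expo)

text \<open>Splitting off the last coordinate multiplies D by an independent uniform factor; the
  recursions in d for the moments of D come from this.\<close>

lemma nn_integral_dom_prob_Suc:
  assumes [measurable]: "f \<in> borel_measurable borel"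
  shows "(\<integral>\<^sup>+ x. f (dom_prob (Suc d) x) \<partial>expo_vec (Suc d))
    = (\<integral>\<^sup>+ x. (\<integral>\<^sup>+ u. f (dom_prob d x * u) * indicator {0..1} u \<partial>lborel) \<partial>expo_vec d)"
proof -
  have m: "(\<lambda>x. f (dom_prob (Suc d) x)) \<in> borel_measurable (PiM (insert d {..<d}) (\<lambda>_. expo))"
    using measurable_compose[OF measurable_dom_prob[of "Suc d"], of f]
    by (simp add: expo_vec_def lessThan_Suc)
  have "(\<integral>\<^sup>+ x. f (dom_prob (Suc d) x) \<partial>expo_vec (Suc d))
    = (\<integral>\<^sup>+ x. (\<integral>\<^sup>+ y. f (dom_prob (Suc d) (x(d := y))) \<partial>expo) \<partial>expo_vec d)"
    unfolding expo_vec_def lessThan_Suc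
    by (rule expo_prod.product_nn_integral_insert[OF _ _ m]) auto
  also have "\<dots> = (\<integral>\<^sup>+ x. (\<integral>\<^sup>+ y. f (dom_prob d x * surv y) \<partial>expo) \<partial>expo_vec d)"
    by (simp add: dom_prob_def)
  also have "\<dots> = (\<integral>\<^sup>+ x. (\<integral>\<^sup>+ u. f (dom_prob d x * u) * indicator {0..1} u \<partial>lborel) \<partial>expo_vec d)"
    by (intro nn_integral_cong nn_integral_surv) auto
  finally show ?thesis .
qed

lemma nn_integral_dom_prob_0: "(\<integral>\<^sup>+ x. f (dom_prob 0 x) \<partial>expo_vec 0) = f 1"
proof -
  interpret prob_space "expo_vec 0" by (rule prob_space_expo_vec)
  show ?thesis using emeasure_space_1 by (simp add: dom_prob_def)
qed

lemma DERIV_power_linear: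
  "((\<lambda>u. (1 - v * u) ^ Suc m) has_real_derivative - ((real m + 1) * v * (1 - v * u) ^ m)) (at u within A)"
proof -
  have "((\<lambda>u. 1 - v * u) has_real_derivative - v) (at u within A)"
    by (auto intro!: derivative_eq_intros)
  from DERIV_power_Suc[OF this, of m] show ?thesis by (simp add: algebra_simps)
qed

text \<open>The antiderivative gives \<open>(1 - (1 - v) ^ Suc m) / (v * (m + 1))\<close>; reading
  the quotient by v as a geometric sum produces the average in \<open>iter_mean\<close>.\<close>

lemma uniform_integral_power:
  fixes v :: real
  assumes v: "0 < v" "v \<le> 1"
  shows "((\<lambda>u. (1 - v * u) ^ m) has_integral (\<Sum>i\<le>m. (1 - v) ^ i) / (real m + 1)) {0..1}"
proof -
  let ?F = "\<lambda>u. - ((1 - v * u) ^ Suc m / (v * (real m + 1)))"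
  have "((\<lambda>u. (1 - v * u) ^ m) has_integral ?F 1 - ?F 0) {0..1}"
  proof (rule fundamental_theorem_of_calculus)
    fix u :: real
    have nz: "v * (real m + 1) \<noteq> 0" using v by simp
    have "(?F has_real_derivative - (- ((real m + 1) * v * (1 - v * u) ^ m) / (v * (real m + 1)))) (at u within {0..1})"
      by (intro DERIV_minus DERIV_cdivide DERIV_power_linear)
    also have "- (- ((real m + 1) * v * (1 - v * u) ^ m) / (v * (real m + 1))) = (1 - v * u) ^ m"
      using nz by simp
    finally show "(?F has_vector_derivative (1 - v * u) ^ m) (at u within {0..1})"
      by (simp add: has_real_derivative_iff_has_vector_derivative)
  qed simp
  also have "?F 1 - ?F 0 = (1 - (1 - v) ^ Suc m) / (v * (real m + 1))"
    by (simp add: diff_divide_distrib)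
  also have "\<dots> = (\<Sum>i\<le>m. (1 - v) ^ i) / (real m + 1)"
    using v by (simp add: sum_gp0)
  finally show ?thesis .
qed

lemma nn_integral_dom_prob_power:
  "(\<integral>\<^sup>+ x. ennreal ((1 - dom_prob d x) ^ m) \<partial>expo_vec d) = ennreal (iter_mean d m)"
proof (induction d arbitrary: m)
  case 0
  show ?case by (subst nn_integral_dom_prob_0) simp
next
  case (Suc d)
  have "(\<integral>\<^sup>+ x. ennreal ((1 - dom_prob (Suc d) x) ^ m) \<partial>expo_vec (Suc d))
    = (\<integral>\<^sup>+ x. (\<integral>\<^sup>+ u. ennreal ((1 - dom_prob d x * u) ^ m) * indicator {0..1} u \<partial>lborel) \<partial>expo_vec d)"
    by (rule nn_integral_dom_prob_Suc) measurable
  also have "\<dots> = (\<integral>\<^sup>+ x. ennreal ((\<Sum>i\<le>m. (1 - dom_prob d x) ^ i) / (real m + 1)) \<partial>expo_vec d)"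
  proof (intro nn_integral_cong nn_integral_has_integral_lebesgue' uniform_integral_power dom_prob_pos dom_prob_le_1)
    fix x :: "nat \<Rightarrow> real" and u :: real assume "u \<in> {0..1}"
    then show "0 \<le> (1 - dom_prob d x * u) ^ m"
      using dom_prob_pos[of d x] dom_prob_le_1[of d x] by (auto intro!: zero_le_power mult_le_one)
  qed
  also have "\<dots> = (\<integral>\<^sup>+ x. ennreal (1 / (real m + 1)) * (\<Sum>i\<le>m. ennreal ((1 - dom_prob d x) ^ i)) \<partial>expo_vec d)"
    using dom_prob_le_1 by (intro nn_integral_cong, subst sum_ennreal)
      (auto simp flip: ennreal_mult' intro!: sum_nonneg)
  also have "\<dots> = ennreal (1 / (real m + 1)) * (\<Sum>i\<le>m. ennreal (iter_mean d i))"
    by (simp add: nn_integral_cmult nn_integral_sum Suc)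
  also have "\<dots> = ennreal (iter_mean (Suc d) m)"
    by (simp add: iter_mean_nonneg sum_nonneg flip: ennreal_mult')
  finally show ?case .
qed

section \<open>The half moments: means of \<open>(1 - D)^m / sqrt D\<close>\<close>

fun half_moment :: "nat \<Rightarrow> nat \<Rightarrow> real" where
  "half_moment 0 m = 0 ^ m"
| "half_moment (Suc d) 0 = 2 * half_moment d 0"
| "half_moment (Suc d) (Suc m) =
    ((2 * real m + 2) * half_moment (Suc d) m + 2 * half_moment d (Suc m)) / (2 * real m + 3)"

text \<open>This is the integral of \<open>(1 - v * u) ^ m / sqrt u\<close> over u in [0, 1]. Its
  recursion in m, averaged over v = D with weight 1 / sqrt D, is the last equation of
  \<open>half_moment\<close>.\<close>

fun half_poly :: "nat \<Rightarrow> real \<Rightarrow> real" where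
  "half_poly 0 v = 2"
| "half_poly (Suc m) v =
    ((2 * real m + 2) * half_poly m v + 2 * (1 - v) ^ Suc m) / (2 * real m + 3)"

lemma half_moment_nonneg: "0 \<le> half_moment d m"
  by (induction d m rule: half_moment.induct) (auto intro!: divide_nonneg_nonneg)

lemma half_poly_nonneg: "v \<le> 1 \<Longrightarrow> 0 \<le> half_poly m v"
  by (induction m) (auto intro!: divide_nonneg_nonneg add_nonneg_nonneg mult_nonneg_nonneg)

lemma measurable_half_poly [measurable]: "half_poly m \<in> borel_measurable borel"
proof (induction m)
  case 0
  have "half_poly 0 = (\<lambda>_. 2)" by auto
  then show ?case by simp
next
  case (Suc m)
  note [measurable] = Suc
  have "half_poly (Suc m) = (\<lambda>v. ((2 * real m + 2) * half_poly m v + 2 * (1 - v) ^ Suc m) / (2 * real m + 3))"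
    by auto
  then show ?case by (simp only:) measurable
qed

lemma has_integral_inverse_sqrt:
  assumes "0 \<le> a"
  shows "((\<lambda>u. 1 / sqrt u) has_integral 2 * sqrt a) {0..a}"
proof -
  have "((\<lambda>u. 1 / sqrt u) has_integral 2 * sqrt a - 2 * sqrt 0) {0..a}"
    using assms by (intro fundamental_theorem_of_calculus_interior continuous_intros)
      (auto intro!: derivative_eq_intros simp: field_simps
        simp flip: has_real_derivative_iff_has_vector_derivative)
  then show ?thesis by simp
qed

lemma uniform_integral_power_sqrt:
  fixes v :: real
  shows "((\<lambda>u. (1 - v * u) ^ m / sqrt u) has_integral half_poly m v) {0..1}"
proof (induction m)
  case 0
  show ?case using has_integral_inverse_sqrt[of 1] by simp
next
  case (Suc m)
  let ?F = "\<lambda>u. sqrt u * (1 - v * u) ^ Suc m"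
  \<comment> \<open>The derivative of \<open>?F\<close>, rewritten with v u = 1 - (1 - v u) so that
    only the integrands for m and m + 1 occur. Integrating it gives the recursion.\<close>
  let ?g = "\<lambda>u. ((real m + 3 / 2) * (1 - v * u) ^ Suc m - (real m + 1) * (1 - v * u) ^ m) / sqrt u"
  have "(?g has_integral ?F 1 - ?F 0) {0..1}"
  proof (rule fundamental_theorem_of_calculus_interior)
    fix u :: real assume u: "u \<in> {0<..<1}"
    have der: "(?F has_real_derivative (inverse (sqrt u) / 2 * (1 - v * u) ^ Suc m + - ((real m + 1) * v * (1 - v * u) ^ m) * sqrt u)) (at u)"
      using u by (intro DERIV_mult DERIV_real_sqrt DERIV_power_linear) auto
    define s p where "s = sqrt u" and "p = (1 - v * u) ^ m"
    have s: "s > 0" "u = s * s" using u by (auto simp: s_def)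
    have "inverse s / 2 * ((1 - v * u) * p) + - ((real m + 1) * v * p) * s
        = ((real m + 3 / 2) * ((1 - v * u) * p) - (real m + 1) * p) / s"
      using s(1) unfolding s(2) by (simp add: field_simps)
    with der show "(?F has_vector_derivative ?g u) (at u)"
      by (simp add: has_real_derivative_iff_has_vector_derivative s_def p_def)
  qed (auto intro!: continuous_intros)
  from has_integral_mult_right[OF has_integral_add[OF this has_integral_mult_right[OF Suc, of "real m + 1"]], of "2 / (2 * real m + 3)"]
  have "((\<lambda>u. 2 / (2 * real m + 3) * (?g u + (real m + 1) * ((1 - v * u) ^ m / sqrt u))) has_integral half_poly (Suc m) v) {0..1}"
    by (simp add: field_simps)
  also have "(\<lambda>u. 2 / (2 * real m + 3) * (?g u + (real m + 1) * ((1 - v * u) ^ m / sqrt u)))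
      = (\<lambda>u. (1 - v * u) ^ Suc m / sqrt u)"
  proof
    fix u
    have "?g u + (real m + 1) * ((1 - v * u) ^ m / sqrt u) = (2 * real m + 3) / 2 * ((1 - v * u) ^ Suc m / sqrt u)"
      by (simp add: diff_divide_distrib add_divide_distrib ring_distribs)
    then show "2 / (2 * real m + 3) * (?g u + (real m + 1) * ((1 - v * u) ^ m / sqrt u)) = (1 - v * u) ^ Suc m / sqrt u"
      by (simp add: add_nonneg_eq_0_iff)
  qed
  finally show ?case .
qed

lemma divide_lincomb:
  fixes a b c h k s :: real
  shows "(a * h + b * k) / c = a / c * h + b / c * k"
    and "(a * h + b * k) / c / s = a / c * (h / s) + b / c * (k / s)"
  by (simp_all add: add_divide_distrib)

text \<open>In 1 / sqrt (D u) the factor 1 / sqrt D comes out of the integral over the last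
  coordinate, leaving \<open>half_poly m D\<close>. The recursion of \<open>half_poly\<close> then
  passes through the mean, so an induction on m sits inside the one on d.\<close>

lemma nn_integral_dom_prob_half_moment:
  "(\<integral>\<^sup>+ x. ennreal ((1 - dom_prob d x) ^ m / sqrt (dom_prob d x)) \<partial>expo_vec d) = ennreal (half_moment d m)"
proof (induction d arbitrary: m)
  case 0
  show ?case by (subst nn_integral_dom_prob_0) simp
next
  case (Suc d)
  have "(\<integral>\<^sup>+ x. ennreal ((1 - dom_prob (Suc d) x) ^ m / sqrt (dom_prob (Suc d) x)) \<partial>expo_vec (Suc d))
    = (\<integral>\<^sup>+ x. (\<integral>\<^sup>+ u. ennreal ((1 - dom_prob d x * u) ^ m / sqrt (dom_prob d x * u)) * indicator {0..1} u \<partial>lborel)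
         \<partial>expo_vec d)"
    by (rule nn_integral_dom_prob_Suc) measurable
  also have "\<dots> = (\<integral>\<^sup>+ x. ennreal (half_poly m (dom_prob d x) / sqrt (dom_prob d x)) \<partial>expo_vec d)"
  proof (intro nn_integral_cong nn_integral_has_integral_lebesgue')
    fix x :: "nat \<Rightarrow> real" and u :: real assume "u \<in> {0..1}"
    then show "0 \<le> (1 - dom_prob d x * u) ^ m / sqrt (dom_prob d x * u)"
      using dom_prob_pos[of d x] dom_prob_le_1[of d x]
      by (auto intro!: divide_nonneg_nonneg zero_le_power mult_le_one)
  next
    fix x :: "nat \<Rightarrow> real"
    show "((\<lambda>u. (1 - dom_prob d x * u) ^ m / sqrt (dom_prob d x * u)) has_integral
        half_poly m (dom_prob d x) / sqrt (dom_prob d x)) {0..1}"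
      using has_integral_divide[OF uniform_integral_power_sqrt, of "dom_prob d x" m "sqrt (dom_prob d x)"]
      by (simp add: real_sqrt_mult mult.commute)
  qed
  also have "\<dots> = ennreal (half_moment (Suc d) m)"
  proof (induction m)
    case 0
    have "(\<integral>\<^sup>+ x. ennreal (half_poly 0 (dom_prob d x) / sqrt (dom_prob d x)) \<partial>expo_vec d)
        = (\<integral>\<^sup>+ x. ennreal 2 * ennreal ((1 - dom_prob d x) ^ 0 / sqrt (dom_prob d x)) \<partial>expo_vec d)"
      by (intro nn_integral_cong, subst ennreal_mult'[symmetric]) auto
    also have "\<dots> = ennreal 2 * ennreal (half_moment d 0)"
      by (subst nn_integral_cmult) (simp, simp only: Suc)
    also have "\<dots> = ennreal (half_moment (Suc d) 0)"
      by (simp add: ennreal_mult')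
    finally show ?case .
  next
    case (Suc m)
    let ?c = "(2 * real m + 2) / (2 * real m + 3)" and ?c' = "2 / (2 * real m + 3)"
    have c: "0 \<le> ?c" "0 \<le> ?c'" by auto
    have "(\<integral>\<^sup>+ x. ennreal (half_poly (Suc m) (dom_prob d x) / sqrt (dom_prob d x)) \<partial>expo_vec d)
        = (\<integral>\<^sup>+ x. ennreal ?c * ennreal (half_poly m (dom_prob d x) / sqrt (dom_prob d x))
            + ennreal ?c' * ennreal ((1 - dom_prob d x) ^ Suc m / sqrt (dom_prob d x)) \<partial>expo_vec d)"
    proof (intro nn_integral_cong)
      fix x
      have eq: "half_poly (Suc m) v / s = ?c * (half_poly m v / s) + ?c' * ((1 - v) ^ Suc m / s)" for v s
        by (simp only: half_poly.simps divide_lincomb(2))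
      have "0 \<le> half_poly m (dom_prob d x) / sqrt (dom_prob d x)"
        "0 \<le> (1 - dom_prob d x) ^ Suc m / sqrt (dom_prob d x)"
        using dom_prob_pos[of d x] dom_prob_le_1[of d x]
        by (auto intro!: divide_nonneg_nonneg half_poly_nonneg mult_nonneg_nonneg)
      then show "ennreal (half_poly (Suc m) (dom_prob d x) / sqrt (dom_prob d x)) =
        ennreal ?c * ennreal (half_poly m (dom_prob d x) / sqrt (dom_prob d x))
            + ennreal ?c' * ennreal ((1 - dom_prob d x) ^ Suc m / sqrt (dom_prob d x))"
        unfolding eq using c by (simp only: ennreal_mult' ennreal_plus mult_nonneg_nonneg)
    qed
    also have "\<dots> = ennreal ?c * ennreal (half_moment (Suc d) m) + ennreal ?c' * ennreal (half_moment d (Suc m))"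
      by (simp add: nn_integral_add nn_integral_cmult Suc \<open>\<And>m. _ = ennreal (half_moment d m)\<close> del: power_Suc)
    also have "\<dots> = ennreal (?c * half_moment (Suc d) m + ?c' * half_moment d (Suc m))"
      using c by (simp only: ennreal_mult' ennreal_plus mult_nonneg_nonneg half_moment_nonneg)
    also have "?c * half_moment (Suc d) m + ?c' * half_moment d (Suc m) = half_moment (Suc d) (Suc m)"
      by (simp only: half_moment.simps divide_lincomb)
    finally show ?case .
  qed
  finally show ?case .
qed

text \<open>After squaring and cancelling m + 1 this says 4 m^2 + 12 m + 8 <= 4 m^2 + 12 m + 9. It
  lets one step of the recursion turn 1 / sqrt (m + 1) into 1 / sqrt (m + 2).\<close>

lemma half_step_le:
  fixes m :: real
  assumes "0 \<le> m"
  shows "(2 * m + 2) / (2 * m + 3) / sqrt (m + 1) \<le> 1 / sqrt (m + 2)"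
proof -
  have "((2 * m + 2) * sqrt (m + 2))\<^sup>2 \<le> ((2 * m + 3) * sqrt (m + 1))\<^sup>2"
    using assms by (simp add: power_mult_distrib) (simp add: power2_eq_square algebra_simps)
  then have "(2 * m + 2) * sqrt (m + 2) \<le> (2 * m + 3) * sqrt (m + 1)"
    by (rule power2_le_imp_le) (use assms in auto)
  then have "(2 * m + 2) * sqrt (m + 2) / ((2 * m + 3) * sqrt (m + 1) * sqrt (m + 2))
      \<le> (2 * m + 3) * sqrt (m + 1) / ((2 * m + 3) * sqrt (m + 1) * sqrt (m + 2))"
    using assms by (intro divide_right_mono) auto
  then show ?thesis using assms by (simp add: add_nonneg_eq_0_iff)
qed

text \<open>The homogeneous part of the recursion decays like 1 / sqrt m by
  \<open>half_step_le\<close>. The other term, with 2 m + 3 weakened to m + 2, appends the next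
  harmonic term, so the inner induction carries the harmonic sum \<open>?S\<close>; it becomes a
  logarithm only at the end.\<close>

lemma half_moment_upper:
  "half_moment (Suc d) m \<le> 2 ^ Suc d * (1 + ln (real m + 1)) ^ d / sqrt (real m + 1)"
proof (induction d arbitrary: m)
  case 0
  show ?case
  proof (induction m)
    case 0
    show ?case by simp
  next
    case (Suc m)
    have "half_moment (Suc 0) (Suc m) = (2 * real m + 2) / (2 * real m + 3) * half_moment (Suc 0) m"
      by simp
    also have "\<dots> \<le> (2 * real m + 2) / (2 * real m + 3) * (2 / sqrt (real m + 1))"
      using Suc by (intro mult_left_mono) auto
    also have "\<dots> = 2 * ((2 * real m + 2) / (2 * real m + 3) / sqrt (real m + 1))"
      by simp
    also have "\<dots> \<le> 2 * (1 / sqrt (real m + 2))"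
      by (intro mult_left_mono half_step_le) auto
    finally show ?case by (simp add: add.commute)
  qed
next
  case (Suc d)
  let ?L = "\<lambda>m. 1 + ln (real m + 1)"
  let ?S = "\<lambda>m. \<Sum>i<Suc m. 1 / (real i + 1)"
  have S: "0 \<le> ?S m" for m by (intro sum_nonneg) auto
  have "half_moment (Suc (Suc d)) m \<le> 2 ^ Suc (Suc d) * ?L m ^ d * ?S m / sqrt (real m + 1)"
  proof (induction m)
    case 0
    show ?case using Suc[of 0] by simp
  next
    case (Suc m)
    have L: "?L m \<le> ?L (Suc m)" "0 \<le> ?L m" by auto
    have "half_moment (Suc (Suc d)) (Suc m) = (2 * real m + 2) / (2 * real m + 3) * half_moment (Suc (Suc d)) m
        + 2 / (2 * real m + 3) * half_moment (Suc d) (Suc m)"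
      by (simp only: half_moment.simps divide_lincomb)
    also have "\<dots> \<le> (2 * real m + 2) / (2 * real m + 3) * (2 ^ Suc (Suc d) * ?L m ^ d * ?S m / sqrt (real m + 1))
        + 2 / (2 * real m + 3) * (2 ^ Suc d * ?L (Suc m) ^ d / sqrt (real (Suc m) + 1))"
      by (intro add_mono mult_left_mono Suc \<open>\<And>m. half_moment (Suc d) m \<le> _ m\<close>) auto
    also have "(2 * real m + 2) / (2 * real m + 3) * (2 ^ Suc (Suc d) * ?L m ^ d * ?S m / sqrt (real m + 1))
        = (2 ^ Suc (Suc d) * ?L m ^ d * ?S m) * ((2 * real m + 2) / (2 * real m + 3) / sqrt (real m + 1))"
      by simp
    also have "\<dots> \<le> (2 ^ Suc (Suc d) * ?L (Suc m) ^ d * ?S m) * (1 / sqrt (real m + 2))"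
      using L S by (intro mult_mono half_step_le power_mono mult_nonneg_nonneg) auto
    also have "2 / (2 * real m + 3) * (2 ^ Suc d * ?L (Suc m) ^ d / sqrt (real (Suc m) + 1))
        \<le> 2 / (real m + 2) * (2 ^ Suc d * ?L (Suc m) ^ d / sqrt (real (Suc m) + 1))"
      by (intro mult_right_mono divide_left_mono) auto
    also have "(2 ^ Suc (Suc d) * ?L (Suc m) ^ d * ?S m) * (1 / sqrt (real m + 2)) +
        2 / (real m + 2) * (2 ^ Suc d * ?L (Suc m) ^ d / sqrt (real (Suc m) + 1))
        = 2 ^ Suc (Suc d) * ?L (Suc m) ^ d * (?S m + 1 / (real m + 2)) / sqrt (real (Suc m) + 1)"
      by (simp add: distrib_left add_divide_distrib add.commute)
    also have "?S m + 1 / (real m + 2) = ?S (Suc m)" by (simp add: add.commute)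
    finally show ?case by simp
  qed
  also have "\<dots> \<le> 2 ^ Suc (Suc d) * ?L m ^ d * ?L m / sqrt (real m + 1)"
    using sum_inverse_le_ln[of "Suc m"] by (intro divide_right_mono mult_left_mono) (auto simp: add.commute)
  finally show ?case by (simp add: mult_ac)
qed

text \<open>Split at u = v: below, the integrand is 1 / (v sqrt u); above, it is
  \<open>u powr (-3/2)\<close>. Both pieces have order 1 / sqrt v, with no logarithm.\<close>

lemma uniform_integral_ratio:
  fixes v :: real
  assumes "0 < v" "v \<le> 1"
  shows "((\<lambda>u. min (u / v) 1 / (u * sqrt u)) has_integral 2 / sqrt v + (2 / sqrt v - 2)) {0..1}"
proof (rule has_integral_combine)
  have "((\<lambda>u. 1 / sqrt u / v) has_integral 2 * sqrt v / v) {0..v}"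
    using assms by (intro has_integral_divide has_integral_inverse_sqrt) auto
  moreover have "2 * sqrt v / v = 2 / sqrt v"
    using assms by (simp add: field_simps)
  \<comment> \<open>At u = 0 both sides are 0 because division by zero yields 0.\<close>
  moreover have "1 / sqrt u / v = min (u / v) 1 / (u * sqrt u)" if "u \<in> {0..v}" for u
    using that assms by (cases "u = 0") (auto simp: min_def field_simps)
  ultimately show "((\<lambda>u. min (u / v) 1 / (u * sqrt u)) has_integral 2 / sqrt v) {0..v}"
    by (metis (no_types, lifting) has_integral_cong)
next
  have "((\<lambda>u. 1 / (u * sqrt u)) has_integral (- 2 / sqrt 1 - (- 2 / sqrt v))) {v..1}"
    using assms by (intro fundamental_theorem_of_calculus)
      (auto intro!: derivative_eq_intros simp: divide_simps
        simp flip: has_real_derivative_iff_has_vector_derivative)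
  moreover have "1 / (u * sqrt u) = min (u / v) 1 / (u * sqrt u)" if "u \<in> {v..1}" for u
    using that assms by (auto simp: min_def field_simps)
  ultimately have "((\<lambda>u. min (u / v) 1 / (u * sqrt u)) has_integral (- 2 / sqrt 1 - (- 2 / sqrt v))) {v..1}"
    by (metis (no_types, lifting) has_integral_cong)
  then show "((\<lambda>u. min (u / v) 1 / (u * sqrt u)) has_integral (2 / sqrt v - 2)) {v..1}"
    by simp
qed (use assms in auto)

section \<open>The pair moment\<close>

text \<open>With s = m D the left side is at most exp (- s), so s sqrt s <= exp s suffices. For r =
  sqrt s, the square \<open>(r * (1 - r))^2\<close> gives 2 r^3 <= r^2 + r^4, which lies below twice
  the quadratic Taylor polynomial of exp at s.\<close>

lemma power_le_three_halves:
  fixes D :: real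
  assumes D: "0 < D" "D \<le> 1" and m: "m \<ge> 1"
  shows "(1 - D) ^ m \<le> 1 / (real m * sqrt (real m)) * (1 / (D * sqrt D))"
proof -
  define s where "s = real m * D"
  have s: "s > 0" using assms by (simp add: s_def)
  have "(1 - D) ^ m \<le> exp (- D) ^ m"
    using D exp_ge_add_one_self[of "- D"] by (intro power_mono) auto
  also have "\<dots> = exp (- s)" by (simp add: s_def exp_of_nat_mult[symmetric])
  also have "s * sqrt s \<le> exp s"
  proof -
    define r where "r = sqrt s"
    have r: "r \<ge> 0" "s = r ^ 2" using s by (auto simp: r_def)
    have "0 \<le> r ^ 2 * (1 - r) ^ 2" by simp
    then have "2 * (r ^ 2 * r) \<le> r ^ 2 + (r ^ 2) ^ 2"
      by (simp add: power2_eq_square algebra_simps)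
    with zero_le_power2[of r] have "r ^ 2 * r \<le> 1 + r ^ 2 + (r ^ 2) ^ 2 / 2"
      by linarith
    with r have "s * sqrt s \<le> 1 + s + s ^ 2 / 2" by simp
    also have "\<dots> \<le> exp s" using s by (intro exp_lower_Taylor_quadratic) auto
    finally show ?thesis .
  qed
  then have "exp (- s) \<le> 1 / (s * sqrt s)"
    using s by (simp add: exp_minus inverse_eq_divide divide_simps)
  also have "s * sqrt s = (real m * sqrt (real m)) * (D * sqrt D)"
    by (simp add: s_def real_sqrt_mult)
  finally show ?thesis by simp
qed

text \<open>The conditional probability that an observation dominates x, given that it dominates
  y.\<close>

definition dom_ratio :: "nat \<Rightarrow> (nat \<Rightarrow> real) \<Rightarrow> (nat \<Rightarrow> real) \<Rightarrow> real" where
  "dom_ratio d x y = dom_prob2 d x y / dom_prob d y"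

lemma dom_ratio_nonneg: "0 \<le> dom_ratio d x y" and dom_ratio_le_1: "dom_ratio d x y \<le> 1"
  using dom_prob2_nonneg[of d x y] dom_prob_pos[of d y] dom_prob2_le[of d x y]
  by (auto simp: dom_ratio_def)

lemma measurable_dom_ratio [measurable (raw)]:
  assumes [measurable]: "f \<in> measurable N (expo_vec d)" "g \<in> measurable N (expo_vec d)"
  shows "(\<lambda>z. dom_ratio d (f z) (g z)) \<in> borel_measurable N"
  unfolding dom_ratio_def by measurable

lemma dom_ratio_eq: "dom_ratio d x y = (\<Prod>j<d. min (surv (x j) / surv (y j)) 1)"
  unfolding dom_ratio_def dom_prob2_def dom_prob_def prod_dividef[symmetric]
proof (intro prod.cong refl)
  fix j
  show "min (surv (x j)) (surv (y j)) / surv (y j) = min (surv (x j) / surv (y j)) 1"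
    using surv_pos[of "y j"] by (auto simp: min_def field_simps)
qed

lemma sqrt_prod: "finite A \<Longrightarrow> sqrt (prod f A) = (\<Prod>i\<in>A. sqrt (f i))"
  by (induction A rule: finite_induct) (auto simp: real_sqrt_mult)

text \<open>Integrand and measure are both products over the coordinates, so this is a product of
  integrals from \<open>uniform_integral_ratio\<close>, each at most 4 / sqrt v.\<close>

lemma nn_integral_dom_ratio:
  "(\<integral>\<^sup>+ x. ennreal (dom_ratio d x y / (dom_prob d x * sqrt (dom_prob d x))) \<partial>expo_vec d)
     \<le> ennreal (4 ^ d / sqrt (dom_prob d y))"
proof -
  let ?f = "\<lambda>v u. min (u / v) 1 / (u * sqrt u)"
  have nn: "0 \<le> ?f (surv (y j)) (surv u)" for j u
    using surv_nonneg by (auto intro!: divide_nonneg_nonneg mult_nonneg_nonneg)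
  have "(\<integral>\<^sup>+ x. ennreal (dom_ratio d x y / (dom_prob d x * sqrt (dom_prob d x))) \<partial>expo_vec d)
      = (\<integral>\<^sup>+ x. (\<Prod>j<d. ennreal (?f (surv (y j)) (surv (x j)))) \<partial>expo_vec d)"
    using nn by (simp add: prod_ennreal dom_ratio_eq dom_prob_def sqrt_prod prod_dividef prod.distrib)
  also have "\<dots> = (\<Prod>j<d. \<integral>\<^sup>+ u. ennreal (?f (surv (y j)) (surv u)) \<partial>expo)"
    unfolding expo_vec_def by (rule expo_prod.product_nn_integral_prod) auto
  also have "\<dots> \<le> (\<Prod>j<d. ennreal (4 / sqrt (surv (y j))))"
  proof (intro prod_mono_ennreal)
    fix j
    have "(\<integral>\<^sup>+ u. ennreal (?f (surv (y j)) (surv u)) \<partial>expo)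
        = (\<integral>\<^sup>+ u. ennreal (?f (surv (y j)) u) * indicator {0..1} u \<partial>lborel)"
      by (rule nn_integral_surv) measurable
    also have "\<dots> = ennreal (2 / sqrt (surv (y j)) + (2 / sqrt (surv (y j)) - 2))"
      using surv_pos[of "y j"] surv_le_1[of "y j"]
      by (intro nn_integral_has_integral_lebesgue' uniform_integral_ratio) auto
    also have "\<dots> \<le> ennreal (4 / sqrt (surv (y j)))"
      by (intro ennreal_leI) auto
    finally show "(\<integral>\<^sup>+ u. ennreal (?f (surv (y j)) (surv u)) \<partial>expo) \<le> ennreal (4 / sqrt (surv (y j)))" .
  qed
  also have "\<dots> = ennreal (4 ^ d / sqrt (dom_prob d y))"
    using surv_nonneg by (simp add: prod_ennreal dom_prob_def sqrt_prod prod_dividef)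
  finally show ?thesis .
qed

text \<open>Only the power belonging to x is replaced by \<open>power_le_three_halves\<close>; the
  power of y stays and meets the 1 / sqrt D(y) from the inner integral, forming a half moment. The
  base 8 is 4 from the coordinate integrals times 2 from \<open>half_moment_upper\<close>, and the
  leading 4 pays for passing from m^2 to (m + 1)^2. For m = 0 the integrand is at most 1.\<close>

lemma nn_integral_pair_moment:
  "(\<integral>\<^sup>+ y. (\<integral>\<^sup>+ x. ennreal (dom_ratio (Suc d) x y * ((1 - dom_prob (Suc d) x) * (1 - dom_prob (Suc d) y)) ^ m)
      \<partial>expo_vec (Suc d)) \<partial>expo_vec (Suc d))
    \<le> ennreal (4 * 8 ^ Suc d * (1 + ln (real m + 1)) ^ d / (real m + 1)\<^sup>2)"
proof (cases "m = 0")
  case True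
  interpret prob_space "expo_vec (Suc d)" by (rule prob_space_expo_vec)
  have "(\<integral>\<^sup>+ y. (\<integral>\<^sup>+ x. ennreal (dom_ratio (Suc d) x y * ((1 - dom_prob (Suc d) x) * (1 - dom_prob (Suc d) y)) ^ m)
      \<partial>expo_vec (Suc d)) \<partial>expo_vec (Suc d)) \<le> (\<integral>\<^sup>+ y. (\<integral>\<^sup>+ x. 1 \<partial>expo_vec (Suc d)) \<partial>expo_vec (Suc d))"
    using True dom_ratio_le_1 by (intro nn_integral_mono) (auto simp: ennreal_le_1)
  also have "\<dots> = 1" by (simp add: emeasure_space_1)
  also have "1 \<le> ennreal (4 * 8 ^ Suc d * (1 + ln (real m + 1)) ^ d / (real m + 1)\<^sup>2)"
  proof -
    have "1 \<le> (8::real) ^ d" by simp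
    then have "1 \<le> 32 * (8::real) ^ d" by linarith
    then show ?thesis
      unfolding ennreal_1[symmetric] using True by (intro ennreal_leI) simp
  qed
  finally show ?thesis .
next
  case False
  define n where "n = Suc d"
  have d: "4 * 8 ^ Suc d * (1 + ln (real m + 1)) ^ d = 4 * 8 ^ n * (1 + ln (real m + 1)) ^ d"
    by (simp add: n_def)
  let ?D = "dom_prob n" and ?c = "1 / (real m * sqrt (real m))"
  have c: "0 \<le> ?c" by simp
  have "(\<integral>\<^sup>+ y. (\<integral>\<^sup>+ x. ennreal (dom_ratio n x y * ((1 - ?D x) * (1 - ?D y)) ^ m) \<partial>expo_vec n) \<partial>expo_vec n)
    \<le> (\<integral>\<^sup>+ y. ennreal (?c * 4 ^ n) * ennreal ((1 - ?D y) ^ m / sqrt (?D y)) \<partial>expo_vec n)"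
  proof (intro nn_integral_mono)
    fix y assume "y \<in> space (expo_vec n)"
    have y: "0 \<le> (1 - ?D y) ^ m" using dom_prob_le_1[of n y] by simp
    have [measurable]: "(\<lambda>x. dom_ratio n x y) \<in> borel_measurable (expo_vec n)"
      using \<open>y \<in> _\<close> by measurable
    have "(\<integral>\<^sup>+ x. ennreal (dom_ratio n x y * ((1 - ?D x) * (1 - ?D y)) ^ m) \<partial>expo_vec n)
        \<le> (\<integral>\<^sup>+ x. ennreal (?c * (1 - ?D y) ^ m) * ennreal (dom_ratio n x y / (?D x * sqrt (?D x))) \<partial>expo_vec n)"
    proof (intro nn_integral_mono)
      fix x
      have "dom_ratio n x y * ((1 - ?D x) * (1 - ?D y)) ^ m = (1 - ?D x) ^ m * (dom_ratio n x y * (1 - ?D y) ^ m)"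
        by (simp add: power_mult_distrib)
      also have "\<dots> \<le> (?c * (1 / (?D x * sqrt (?D x)))) * (dom_ratio n x y * (1 - ?D y) ^ m)"
        using False y dom_ratio_nonneg[of n x y]
        by (intro mult_right_mono power_le_three_halves dom_prob_pos dom_prob_le_1) auto
      also have "\<dots> = (?c * (1 - ?D y) ^ m) * (dom_ratio n x y / (?D x * sqrt (?D x)))"
        by simp
      finally show "ennreal (dom_ratio n x y * ((1 - ?D x) * (1 - ?D y)) ^ m)
          \<le> ennreal (?c * (1 - ?D y) ^ m) * ennreal (dom_ratio n x y / (?D x * sqrt (?D x)))"
        using c y by (subst ennreal_mult'[symmetric]) (auto intro!: ennreal_leI)
    qed
    also have "\<dots> = ennreal (?c * (1 - ?D y) ^ m) * (\<integral>\<^sup>+ x. ennreal (dom_ratio n x y / (?D x * sqrt (?D x))) \<partial>expo_vec n)"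
      by (rule nn_integral_cmult) measurable
    also have "\<dots> \<le> ennreal (?c * (1 - ?D y) ^ m) * ennreal (4 ^ n / sqrt (?D y))"
      by (intro mult_left_mono nn_integral_dom_ratio) auto
    also have "\<dots> = ennreal (?c * 4 ^ n) * ennreal ((1 - ?D y) ^ m / sqrt (?D y))"
      using c y by (subst (1 2) ennreal_mult'[symmetric]) (auto simp: mult_ac)
    finally show "(\<integral>\<^sup>+ x. ennreal (dom_ratio n x y * ((1 - ?D x) * (1 - ?D y)) ^ m) \<partial>expo_vec n)
        \<le> ennreal (?c * 4 ^ n) * ennreal ((1 - ?D y) ^ m / sqrt (?D y))" .
  qed
  also have "\<dots> = ennreal (?c * 4 ^ n) * ennreal (half_moment n m)"
    by (subst nn_integral_cmult) (auto simp: nn_integral_dom_prob_half_moment)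
  also have "\<dots> = ennreal (?c * 4 ^ n * half_moment n m)"
    by (rule ennreal_mult'[symmetric]) simp
  also have "\<dots> \<le> ennreal (4 * 8 ^ n * (1 + ln (real m + 1)) ^ d / (real m + 1)\<^sup>2)"
  proof (intro ennreal_leI)
    let ?L = "(1 + ln (real m + 1)) ^ d"
    have m: "1 \<le> real m" using False by simp
    have "?c * (1 / sqrt (real m + 1)) \<le> ?c * (1 / sqrt (real m))"
      using m by (intro mult_left_mono divide_left_mono) auto
    also have "\<dots> = 1 / (real m)\<^sup>2"
      using m by (simp add: power2_eq_square)
    also have "\<dots> = 4 / (2 * real m)\<^sup>2" by simp
    also have "\<dots> \<le> 4 / (real m + 1)\<^sup>2"
      using m by (intro divide_left_mono power_mono) auto
    finally have *: "?c * (1 / sqrt (real m + 1)) \<le> 4 / (real m + 1)\<^sup>2" .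
    have "?c * 4 ^ n * half_moment n m \<le> ?c * 4 ^ n * (2 ^ n * ?L / sqrt (real m + 1))"
      unfolding n_def by (intro mult_left_mono half_moment_upper) auto
    also have "\<dots> = ((4 * 2) ^ n * ?L) * (?c * (1 / sqrt (real m + 1)))"
      by (simp only: power_mult_distrib) simp
    also have "\<dots> \<le> ((4 * 2) ^ n * ?L) * (4 / (real m + 1)\<^sup>2)"
      using * by (intro mult_left_mono) auto
    finally show "?c * 4 ^ n * half_moment n m \<le> 4 * 8 ^ n * ?L / (real m + 1)\<^sup>2"
      by (simp add: mult_ac)
  qed
  finally show ?thesis unfolding d by (simp add: n_def)
qed

section \<open>Independent exponential observations\<close>

text \<open>The probability that an observation dominates neither x nor y.\<close>
definition avoid2 :: "nat \<Rightarrow> (nat \<Rightarrow> real) \<Rightarrow> (nat \<Rightarrow> real) \<Rightarrow> real" where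
  "avoid2 d x y = 1 - dom_prob d x - dom_prob d y + dom_prob2 d x y"

lemma measurable_avoid2 [measurable (raw)]:
  assumes "f \<in> measurable N (expo_vec d)" "g \<in> measurable N (expo_vec d)"
  shows "(\<lambda>z. avoid2 d (f z) (g z)) \<in> borel_measurable N"
  unfolding avoid2_def
  by (intro borel_measurable_add borel_measurable_diff borel_measurable_const
    measurable_compose[OF _ measurable_dom_prob] measurable_dom_prob2 assms)

lemma measurable_strictly_dominated [measurable (raw)]:
  assumes "f \<in> measurable N (expo_vec d)" "g \<in> measurable N (expo_vec d)"
  shows "Measurable.pred N (\<lambda>z. strictly_dominated d (f z) (g z))"
proof -
  have eq: "strictly_dominated d x y \<longleftrightarrow> (\<forall>j\<in>{..<d}. x j < y j)" for x y
    by (auto simp: strictly_dominated_def)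
  show ?thesis
    unfolding eq
  proof (rule pred_intros_finite(3))
    fix j assume j: "j \<in> {..<d}"
    then have j: "j < d" by simp
    show "Measurable.pred N (\<lambda>z. f z j < g z j)"
      by (rule borel_measurable_pred_less[OF measurable_expo_vec_component[OF j assms(1)]
        measurable_expo_vec_component[OF j assms(2)]])
  qed simp
qed

lemma measure_strictly_dominated:
  "measure (expo_vec d) {z \<in> space (expo_vec d). strictly_dominated d x z} = dom_prob d x"
proof -
  interpret prob_space expo by (rule prob_space_expo)
  interpret vec: prob_space "expo_vec d" by (rule prob_space_expo_vec)
  have "{z \<in> space (expo_vec d). strictly_dominated d x z} = PiE {..<d} (\<lambda>j. {x j<..})"
    by (auto simp: expo_vec_def space_PiM strictly_dominated_def PiE_def Pi_def)
  then have "emeasure (expo_vec d) {z \<in> space (expo_vec d). strictly_dominated d x z}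
      = (\<Prod>j<d. emeasure expo {x j<..})"
    unfolding expo_vec_def by (simp add: expo_prod.emeasure_PiM)
  also have "\<dots> = ennreal (dom_prob d x)"
    by (simp add: emeasure_eq_measure measure_expo_greaterThan surv_nonneg prod_ennreal dom_prob_def)
  finally show ?thesis
    using dom_prob_pos[of d x] by (simp add: vec.emeasure_eq_measure)
qed

text \<open>Reduces domination of two points to one, so inclusion-exclusion for
  \<open>avoid2\<close> uses only \<open>measure_strictly_dominated\<close>.\<close>

lemma strictly_dominated_max:
  "strictly_dominated d x z \<and> strictly_dominated d y z \<longleftrightarrow> strictly_dominated d (\<lambda>j. max (x j) (y j)) z"
  by (auto simp: strictly_dominated_def)

lemma dom_prob_max: "dom_prob d (\<lambda>j. max (x j) (y j)) = dom_prob2 d x y"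
  unfolding dom_prob_def dom_prob2_def by (intro prod.cong) (auto simp: surv_def max_def min_def)

lemma sets_strictly_dominated [measurable]:
  "{z \<in> space (expo_vec d). strictly_dominated d x z} \<in> sets (expo_vec d)"
proof -
  have "{z \<in> space (expo_vec d). strictly_dominated d x z} = PiE {..<d} (\<lambda>j. {x j<..})"
    by (auto simp: expo_vec_def space_PiM strictly_dominated_def PiE_def Pi_def)
  then show ?thesis
    unfolding expo_vec_def by (auto intro!: sets_PiM_I_finite simp: sets_expo)
qed

lemma measure_avoid:
  "measure (expo_vec d) {z \<in> space (expo_vec d). \<not> strictly_dominated d x z} = 1 - dom_prob d x"
proof -
  interpret vec: prob_space "expo_vec d" by (rule prob_space_expo_vec)
  have "{z \<in> space (expo_vec d). \<not> strictly_dominated d x z}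
      = space (expo_vec d) - {z \<in> space (expo_vec d). strictly_dominated d x z}" by auto
  then show ?thesis
    by (simp add: vec.prob_compl measure_strictly_dominated sets_strictly_dominated)
qed

lemma measure_avoid2:
  "measure (expo_vec d) {z \<in> space (expo_vec d). \<not> strictly_dominated d x z \<and> \<not> strictly_dominated d y z}
    = avoid2 d x y"
proof -
  interpret vec: prob_space "expo_vec d" by (rule prob_space_expo_vec)
  let ?S = "\<lambda>x. {z \<in> space (expo_vec d). strictly_dominated d x z}"
  have "{z \<in> space (expo_vec d). \<not> strictly_dominated d x z \<and> \<not> strictly_dominated d y z}
      = space (expo_vec d) - (?S x \<union> ?S y)" by auto
  moreover have "measure (expo_vec d) (space (expo_vec d) - (?S x \<union> ?S y)) = 1 - measure (expo_vec d) (?S x \<union> ?S y)"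
    by (intro vec.prob_compl) auto
  moreover have "measure (expo_vec d) (?S x \<union> ?S y)
      = measure (expo_vec d) (?S x) + measure (expo_vec d) (?S y) - measure (expo_vec d) (?S x \<inter> ?S y)"
    by (intro measure_Un3) (auto simp: vec.fmeasurable_eq_sets)
  moreover have "?S x \<inter> ?S y = ?S (\<lambda>j. max (x j) (y j))"
    using strictly_dominated_max by blast
  ultimately show ?thesis
    by (simp add: measure_strictly_dominated dom_prob_max avoid2_def)
qed

lemma avoid2_nonneg: "0 \<le> avoid2 d x y"
  unfolding measure_avoid2[symmetric] by simp

lemma avoid2_le: "avoid2 d x y \<le> 1 - dom_prob d x" "avoid2 d x y \<le> 1 - dom_prob d y"
  using dom_prob2_le[of d x y] by (auto simp: avoid2_def)

section \<open>The sample of observations\<close>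

locale iid_exponentials = prob_space M for M :: "'a measure" +
  fixes Y :: "nat \<Rightarrow> nat \<Rightarrow> 'a \<Rightarrow> real" and d :: nat
  assumes dim_pos: "d \<ge> 1"
    and indep: "indep_vars (\<lambda>_. borel) (\<lambda>(k, j). Y k j) ({1..} \<times> {..<d})"
    and exponential: "\<And>k j. k \<ge> 1 \<Longrightarrow> j < d \<Longrightarrow> distributed M lborel (Y k j) (exponential_density 1)"
begin

text \<open>Restricting to coordinates below d puts the values into the space of
  \<open>expo_vec d\<close>, whose elements are extensional functions.\<close>

definition obs :: "nat \<Rightarrow> 'a \<Rightarrow> nat \<Rightarrow> real" where
  "obs k \<omega> = (\<lambda>j\<in>{..<d}. Y k j \<omega>)"

lemma strictly_dominated_obs:
  "strictly_dominated d (obs k \<omega>) (obs i \<omega>) \<longleftrightarrow> strictly_dominated d (\<lambda>j. Y k j \<omega>) (\<lambda>j. Y i j \<omega>)"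
  by (simp add: strictly_dominated_def obs_def)

lemma measurable_Y: "k \<ge> 1 \<Longrightarrow> j < d \<Longrightarrow> Y k j \<in> borel_measurable M"
  using distributed_measurable[OF exponential, of k j] by simp

text \<open>The independent coordinates are grouped by their observation index; the composed map
  renames the coordinate (k, j) to j.\<close>

lemma indep_obs: "indep_vars (\<lambda>_. PiM {..<d} (\<lambda>_. borel)) obs {1..}"
proof -
  have "indep_vars (\<lambda>k. PiM ({k} \<times> {..<d}) (\<lambda>_. borel))
      (\<lambda>k \<omega>. restrict (\<lambda>i. (case i of (k, j) \<Rightarrow> Y k j) \<omega>) ({k} \<times> {..<d})) {1..}"
    by (rule indep_vars_restrict[OF indep]) (auto simp: disjoint_family_on_def)
  then have "indep_vars (\<lambda>_. PiM {..<d} (\<lambda>_. borel))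
      (\<lambda>k \<omega>. (\<lambda>f. \<lambda>j\<in>{..<d}. f (k, j)) (restrict (\<lambda>i. (case i of (k, j) \<Rightarrow> Y k j) \<omega>) ({k} \<times> {..<d}))) {1..}"
    by (rule indep_vars_compose2) (rule measurable_restrict, rule measurable_component_singleton, simp)
  also have "(\<lambda>k \<omega>. (\<lambda>f. \<lambda>j\<in>{..<d}. f (k, j)) (restrict (\<lambda>i. (case i of (k, j) \<Rightarrow> Y k j) \<omega>) ({k} \<times> {..<d}))) = obs"
    by (auto simp: obs_def fun_eq_iff restrict_def)
  finally show ?thesis .
qed

lemma measurable_obs [measurable]: "k \<ge> 1 \<Longrightarrow> obs k \<in> measurable M (expo_vec d)"
  using indep_obs unfolding indep_vars_def measurable_cong_sets[OF refl sets_expo_vec] by simp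

lemma distr_obs:
  assumes k: "k \<ge> 1"
  shows "distr M (PiM {..<d} (\<lambda>_. borel)) (obs k) = expo_vec d"
proof -
  have "indep_vars (\<lambda>j. PiM {(k, j)} (\<lambda>_. borel))
      (\<lambda>j \<omega>. restrict (\<lambda>i. (case i of (k, j) \<Rightarrow> Y k j) \<omega>) {(k, j)}) {..<d}"
    by (rule indep_vars_restrict[OF indep]) (use k in \<open>auto simp: disjoint_family_on_def\<close>)
  then have "indep_vars (\<lambda>_. borel)
      (\<lambda>j \<omega>. (\<lambda>f. f (k, j)) (restrict (\<lambda>i. (case i of (k, j) \<Rightarrow> Y k j) \<omega>) {(k, j)})) {..<d}"
    by (rule indep_vars_compose2) (rule measurable_component_singleton, simp)
  then have ind: "indep_vars (\<lambda>_. borel) (\<lambda>j. Y k j) {..<d}"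
    by simp
  have Y: "distr M borel (Y k j) = expo" if "j < d" for j
  proof -
    have "distr M borel (Y k j) = distr M lborel (Y k j)"
      by (intro distr_cong) auto
    then show ?thesis
      using distributed_distr_eq_density[OF exponential[OF k that]] by (simp add: expo_def)
  qed
  \<comment> \<open>The product form of independence needs a nonempty index set, hence
    \<open>dim_pos\<close>.\<close>
  have "distr M (PiM {..<d} (\<lambda>_. borel)) (obs k) = PiM {..<d} (\<lambda>j. distr M borel (Y k j))"
    using ind measurable_Y[OF k] dim_pos unfolding obs_def
    by (subst (asm) indep_vars_iff_distr_eq_PiM') (auto simp: lessThan_empty_iff)
  also have "\<dots> = expo_vec d"
    unfolding expo_vec_def by (intro PiM_cong) (auto simp: Y)
  finally show ?thesis .
qed

lemma nn_integral_obs: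
  assumes J: "J \<noteq> {}" "J \<subseteq> {1..}"
    and f: "f \<in> borel_measurable (PiM J (\<lambda>_. expo_vec d))"
  shows "(\<integral>\<^sup>+ \<omega>. f (\<lambda>k\<in>J. obs k \<omega>) \<partial>M) = integral\<^sup>N (PiM J (\<lambda>_. expo_vec d)) f"
proof -
  have sets: "sets (PiM J (\<lambda>_. expo_vec d)) = sets (PiM J (\<lambda>_. PiM {..<d} (\<lambda>_. borel)))"
    by (intro sets_PiM_cong) (auto simp: sets_expo_vec)
  have rv: "obs k \<in> measurable M (PiM {..<d} (\<lambda>_. borel))" if "k \<in> J" for k
    using measurable_obs[of k] J that by (auto simp: measurable_cong_sets[OF refl sets_expo_vec])
  have "distr M (PiM J (\<lambda>_. PiM {..<d} (\<lambda>_. borel))) (\<lambda>\<omega>. \<lambda>k\<in>J. obs k \<omega>)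
      = PiM J (\<lambda>k. distr M (PiM {..<d} (\<lambda>_. borel)) (obs k))"
    using indep_vars_subset[OF indep_obs J(2)] rv J(1) by (subst (asm) indep_vars_iff_distr_eq_PiM') auto
  also have "\<dots> = PiM J (\<lambda>_. expo_vec d)"
    using J by (intro PiM_cong) (auto intro!: distr_obs)
  finally have eq: "PiM J (\<lambda>_. expo_vec d) = distr M (PiM J (\<lambda>_. PiM {..<d} (\<lambda>_. borel))) (\<lambda>\<omega>. \<lambda>k\<in>J. obs k \<omega>)" ..
  have "f \<in> borel_measurable (PiM J (\<lambda>_. PiM {..<d} (\<lambda>_. borel)))"
    using f unfolding measurable_cong_sets[OF sets refl] .
  moreover have "(\<lambda>\<omega>. \<lambda>k\<in>J. obs k \<omega>) \<in> measurable M (PiM J (\<lambda>_. PiM {..<d} (\<lambda>_. borel)))"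
    by (rule measurable_restrict) (rule rv)
  ultimately show ?thesis
    unfolding eq by (simp add: nn_integral_distr)
qed

end

lemma prod_if_one_zero:
  "finite J \<Longrightarrow> (\<Prod>l\<in>J. if P l then 1 else 0) = (if \<forall>l\<in>J. P l then 1 else (0 :: 'b :: comm_semiring_1))"
  by (induction J rule: finite_induct) auto

section \<open>The joint law of two independent observations\<close>

definition pair_expo :: "nat \<Rightarrow> ((nat \<Rightarrow> real) \<times> (nat \<Rightarrow> real)) measure" where
  "pair_expo d = expo_vec d \<Otimes>\<^sub>M expo_vec d"

lemma sets_pair_expo [measurable_cong]: "sets (pair_expo d) = sets (expo_vec d \<Otimes>\<^sub>M expo_vec d)"
  by (simp add: pair_expo_def)

lemma prob_space_pair_expo: "prob_space (pair_expo d)"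
proof -
  interpret v: prob_space "expo_vec d" by (rule prob_space_expo_vec)
  interpret pair_prob_space "expo_vec d" "expo_vec d" ..
  show ?thesis unfolding pair_expo_def by (rule prob_space_axioms)
qed

lemma measurable_fst_pair_expo [measurable]: "fst \<in> measurable (pair_expo d) (expo_vec d)"
  and measurable_snd_pair_expo [measurable]: "snd \<in> measurable (pair_expo d) (expo_vec d)"
  by (simp_all add: pair_expo_def)

lemma integrable_pair_expo:
  fixes f :: "(nat \<Rightarrow> real) \<times> (nat \<Rightarrow> real) \<Rightarrow> real"
  assumes "f \<in> borel_measurable (pair_expo d)" "\<And>z. \<bar>f z\<bar> \<le> B"
  shows "integrable (pair_expo d) f"
proof -
  interpret prob_space "pair_expo d" by (rule prob_space_pair_expo)
  show ?thesis using assms by (intro integrable_const_bound[where B = B]) auto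
qed

lemma nn_integral_pair_expo:
  assumes "f \<in> borel_measurable (pair_expo d)"
  shows "(\<integral>\<^sup>+ x. (\<integral>\<^sup>+ y. f (x, y) \<partial>expo_vec d) \<partial>expo_vec d) = integral\<^sup>N (pair_expo d) f"
    and "(\<integral>\<^sup>+ y. (\<integral>\<^sup>+ x. f (x, y) \<partial>expo_vec d) \<partial>expo_vec d) = integral\<^sup>N (pair_expo d) f"
proof -
  interpret v: prob_space "expo_vec d" by (rule prob_space_expo_vec)
  interpret pair_prob_space "expo_vec d" "expo_vec d" ..
  show "(\<integral>\<^sup>+ x. (\<integral>\<^sup>+ y. f (x, y) \<partial>expo_vec d) \<partial>expo_vec d) = integral\<^sup>N (pair_expo d) f"
    using v.nn_integral_fst[of f "expo_vec d"] assms by (simp add: pair_expo_def)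
  show "(\<integral>\<^sup>+ y. (\<integral>\<^sup>+ x. f (x, y) \<partial>expo_vec d) \<partial>expo_vec d) = integral\<^sup>N (pair_expo d) f"
    using nn_integral_snd[of f] assms by (simp add: pair_expo_def)
qed

lemma integral_pair_expo_product:
  "(\<integral>z. (1 - dom_prob d (fst z)) ^ m * (1 - dom_prob d (snd z)) ^ n \<partial>pair_expo d)
    = iter_mean d m * iter_mean d n"
proof -
  let ?f = "\<lambda>z. (1 - dom_prob d (fst z)) ^ m * (1 - dom_prob d (snd z)) ^ n"
  have nn: "0 \<le> (1 - dom_prob d x) ^ k" for x k using dom_prob_le_1 by simp
  have "ennreal (\<integral>z. ?f z \<partial>pair_expo d) = (\<integral>\<^sup>+z. ennreal (?f z) \<partial>pair_expo d)"
  proof (intro nn_integral_eq_integral[symmetric] integrable_pair_expo[where B = 1] AE_I2)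
    fix z :: "(nat \<Rightarrow> real) \<times> (nat \<Rightarrow> real)"
    show "\<bar>?f z\<bar> \<le> 1"
      using dom_prob_pos[of d "fst z"] dom_prob_pos[of d "snd z"] nn
      by (auto simp: abs_mult intro!: mult_le_one power_le_one dom_prob_le_1)
  qed (auto simp: nn)
  also have "\<dots> = (\<integral>\<^sup>+x. (\<integral>\<^sup>+y. ennreal (?f (x, y)) \<partial>expo_vec d) \<partial>expo_vec d)"
    by (intro nn_integral_pair_expo(1)[symmetric]) measurable
  also have "\<dots> = (\<integral>\<^sup>+x. ennreal ((1 - dom_prob d x) ^ m) * ennreal (iter_mean d n) \<partial>expo_vec d)"
    using nn by (simp add: ennreal_mult' nn_integral_cmult nn_integral_dom_prob_power)
  also have "\<dots> = ennreal (iter_mean d m) * ennreal (iter_mean d n)"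
    by (subst nn_integral_multc) (auto simp: nn_integral_dom_prob_power)
  also have "\<dots> = ennreal (iter_mean d m * iter_mean d n)"
    by (simp add: ennreal_mult' iter_mean_nonneg)
  finally show ?thesis
    by (subst (asm) ennreal_inj) (auto intro!: Bochner_Integration.integral_nonneg mult_nonneg_nonneg iter_mean_nonneg nn)
qed

lemma integral_pair_moment:
  assumes "d \<ge> 1"
  shows "(\<integral>z. dom_ratio d (fst z) (snd z) * ((1 - dom_prob d (fst z)) * (1 - dom_prob d (snd z))) ^ m \<partial>pair_expo d)
    \<le> 4 * 8 ^ d * (1 + ln (real m + 1)) ^ (d - 1) / (real m + 1)\<^sup>2"
proof -
  let ?f = "\<lambda>z. dom_ratio d (fst z) (snd z) * ((1 - dom_prob d (fst z)) * (1 - dom_prob d (snd z))) ^ m"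
  have nn: "0 \<le> ?f z" for z
    using dom_prob_le_1[of d "fst z"] dom_prob_le_1[of d "snd z"] by (simp add: dom_ratio_nonneg)
  have "ennreal (\<integral>z. ?f z \<partial>pair_expo d) = (\<integral>\<^sup>+z. ennreal (?f z) \<partial>pair_expo d)"
  proof (intro nn_integral_eq_integral[symmetric] integrable_pair_expo[where B = 1] AE_I2 nn)
    fix z :: "(nat \<Rightarrow> real) \<times> (nat \<Rightarrow> real)"
    have "?f z \<le> 1"
      using dom_prob_pos[of d "fst z"] dom_prob_pos[of d "snd z"] dom_prob_le_1[of d "fst z"] dom_prob_le_1[of d "snd z"]
      by (intro mult_le_one dom_ratio_le_1 power_le_one mult_nonneg_nonneg zero_le_power) auto
    with nn[of z] show "\<bar>?f z\<bar> \<le> 1" by simp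
  qed measurable
  \<comment> \<open>The integral over the first component is put innermost, the order treated by
    \<open>nn_integral_pair_moment\<close>.\<close>
  also have "\<dots> = (\<integral>\<^sup>+y. (\<integral>\<^sup>+x. ennreal (?f (x, y)) \<partial>expo_vec d) \<partial>expo_vec d)"
    by (intro nn_integral_pair_expo(2)[symmetric]) measurable
  also have "\<dots> \<le> ennreal (4 * 8 ^ d * (1 + ln (real m + 1)) ^ (d - 1) / (real m + 1)\<^sup>2)"
    using nn_integral_pair_moment[of "d - 1" m] assms by simp
  finally show ?thesis
    by (subst (asm) ennreal_le_iff) auto
qed

section \<open>Probabilities of not being dominated\<close>

context iid_exponentials
begin

abbreviation dominated :: "nat \<Rightarrow> nat \<Rightarrow> 'a \<Rightarrow> bool" where
  "dominated i l \<omega> \<equiv> strictly_dominated d (\<lambda>j. Y i j \<omega>) (\<lambda>j. Y l j \<omega>)"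

lemma measurable_dominated [measurable]:
  assumes "i \<ge> 1" "l \<ge> 1"
  shows "Measurable.pred M (dominated i l)"
  using measurable_strictly_dominated[OF measurable_obs[OF assms(1)] measurable_obs[OF assms(2)]]
  by (simp add: strictly_dominated_obs)

text \<open>Given the values x and y of observations i and k, the others are independent: those in A
  must dominate neither point, those in B must not dominate y. A pair of records has A before both
  and B between them; a pair of current records has B empty.\<close>

lemma prob_avoid_pair:
  assumes "finite A" "finite B" "A \<inter> B = {}" "i \<notin> A \<union> B" "k \<notin> A \<union> B" "i \<noteq> k"
    and pos: "i \<ge> 1" "k \<ge> 1" "A \<union> B \<subseteq> {1..}"
  shows "prob {\<omega> \<in> space M. (\<forall>l\<in>A. \<not> dominated i l \<omega> \<and> \<not> dominated k l \<omega>) \<and> (\<forall>l\<in>B. \<not> dominated k l \<omega>)}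
    = (\<integral>z. avoid2 d (fst z) (snd z) ^ card A * (1 - dom_prob d (snd z)) ^ card B \<partial>pair_expo d)"
proof -
  interpret v: prob_space "expo_vec d" by (rule prob_space_expo_vec)
  interpret P: product_sigma_finite "\<lambda>_::nat. expo_vec d"
    by (intro product_sigma_finite.intro prob_space_imp_sigma_finite prob_space_expo_vec)
  let ?N = "expo_vec d"
  define J where "J = A \<union> B"
  define K where "K = insert i (insert k J)"
  have J: "finite J" "i \<notin> insert k J" "k \<notin> J" "i \<notin> J" using assms by (auto simp: J_def)
  have K: "K \<noteq> {}" "K \<subseteq> {1..}" using pos by (auto simp: K_def J_def)
  \<comment> \<open>\<open>G\<close> is the indicator of the condition on observation l once the two
    points are fixed, and \<open>h\<close> is its mean.\<close>
  define G :: "nat \<Rightarrow> (nat \<Rightarrow> real) \<Rightarrow> (nat \<Rightarrow> real) \<Rightarrow> (nat \<Rightarrow> real) \<Rightarrow> ennreal" where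
    "G l x y w = (if (l \<in> A \<longrightarrow> \<not> strictly_dominated d x w) \<and> \<not> strictly_dominated d y w then 1 else 0)" for l x y w
  define h where "h l x y = (if l \<in> A then avoid2 d x y else 1 - dom_prob d y)" for l x y
  have Gm: "(\<lambda>z. G l (f z) (g z) (w z)) \<in> borel_measurable N"
    if [measurable]: "f \<in> measurable N ?N" "g \<in> measurable N ?N" "w \<in> measurable N ?N" for l f g w and N :: "'z measure"
    unfolding G_def by measurable
  have Gint: "(\<integral>\<^sup>+ w. G l x y w \<partial>?N) = ennreal (h l x y)" if "x \<in> space ?N" "y \<in> space ?N" for l x y
  proof -
    let ?S = "{w \<in> space ?N. (l \<in> A \<longrightarrow> \<not> strictly_dominated d x w) \<and> \<not> strictly_dominated d y w}"
    have [measurable]: "?S \<in> sets ?N" using that by measurable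
    have "(\<integral>\<^sup>+ w. G l x y w \<partial>?N) = (\<integral>\<^sup>+ w. indicator ?S w \<partial>?N)"
      by (intro nn_integral_cong) (auto simp: G_def indicator_def)
    also have "\<dots> = ennreal (measure ?N ?S)"
      by (simp add: v.emeasure_eq_measure)
    also have "measure ?N ?S = h l x y"
      unfolding h_def by (cases "l \<in> A") (simp_all add: measure_avoid measure_avoid2)
    finally show ?thesis .
  qed
  define F where "F z = (\<Prod>l\<in>J. G l (z i) (z k) (z l))" for z
  have Fm: "F \<in> borel_measurable (PiM K (\<lambda>_. ?N))"
    unfolding F_def by (intro borel_measurable_prod_ennreal Gm measurable_component_singleton) (auto simp: K_def)
  let ?E = "{\<omega> \<in> space M. (\<forall>l\<in>A. \<not> dominated i l \<omega> \<and> \<not> dominated k l \<omega>) \<and> (\<forall>l\<in>B. \<not> dominated k l \<omega>)}"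
  have E: "?E \<in> sets M"
  proof -
    have "Measurable.pred M (\<lambda>\<omega>. (\<forall>l\<in>A. \<not> dominated i l \<omega> \<and> \<not> dominated k l \<omega>) \<and> (\<forall>l\<in>B. \<not> dominated k l \<omega>))"
      using assms by (intro pred_intros_logic pred_intros_finite(3) measurable_dominated) auto
    then show ?thesis by simp
  qed
  have "ennreal (prob ?E) = (\<integral>\<^sup>+ \<omega>. indicator ?E \<omega> \<partial>M)"
    using E by (simp add: emeasure_eq_measure)
  also have "\<dots> = (\<integral>\<^sup>+ \<omega>. F (\<lambda>k\<in>K. obs k \<omega>) \<partial>M)"
  proof (intro nn_integral_cong)
    fix \<omega> assume "\<omega> \<in> space M"
    have "F (\<lambda>k\<in>K. obs k \<omega>) = (\<Prod>l\<in>J. G l (obs i \<omega>) (obs k \<omega>) (obs l \<omega>))"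
      unfolding F_def by (intro prod.cong) (auto simp: K_def)
    also have "\<dots> = indicator ?E \<omega>"
      unfolding G_def prod_if_one_zero[OF J(1)] strictly_dominated_obs
      using \<open>\<omega> \<in> space M\<close> by (auto simp: J_def indicator_def)
    finally show "indicator ?E \<omega> = F (\<lambda>k\<in>K. obs k \<omega>)" by simp
  qed
  also have "\<dots> = integral\<^sup>N (PiM K (\<lambda>_. ?N)) F"
    by (rule nn_integral_obs[OF K Fm])
  \<comment> \<open>Fubini with observation i outermost and k next; the remaining integrals then
    factor over l.\<close>
  also have "\<dots> = (\<integral>\<^sup>+ x. (\<integral>\<^sup>+ z. F (z(i := x)) \<partial>PiM (insert k J) (\<lambda>_. ?N)) \<partial>?N)"
    unfolding K_def using J Fm by (intro P.product_nn_integral_insert_rev) (auto simp: K_def)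
  also have "\<dots> = (\<integral>\<^sup>+ x. (\<integral>\<^sup>+ y. ennreal (avoid2 d x y ^ card A * (1 - dom_prob d y) ^ card B) \<partial>?N) \<partial>?N)"
  proof (intro nn_integral_cong)
    fix x assume x: "x \<in> space ?N"
    have "(\<integral>\<^sup>+ z. F (z(i := x)) \<partial>PiM (insert k J) (\<lambda>_. ?N))
        = (\<integral>\<^sup>+ z. (\<Prod>l\<in>J. G l x (z k) (z l)) \<partial>PiM (insert k J) (\<lambda>_. ?N))"
      using J by (intro nn_integral_cong) (auto simp: F_def intro!: prod.cong)
    also have "\<dots> = (\<integral>\<^sup>+ y. (\<integral>\<^sup>+ z. (\<Prod>l\<in>J. G l x ((z(k := y)) k) ((z(k := y)) l)) \<partial>PiM J (\<lambda>_. ?N)) \<partial>?N)"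
      using J x by (intro P.product_nn_integral_insert_rev borel_measurable_prod_ennreal Gm measurable_component_singleton
        measurable_const) auto
    also have "\<dots> = (\<integral>\<^sup>+ y. (\<integral>\<^sup>+ z. (\<Prod>l\<in>J. G l x y (z l)) \<partial>PiM J (\<lambda>_. ?N)) \<partial>?N)"
      using J by (intro nn_integral_cong) (auto intro!: prod.cong)
    also have "\<dots> = (\<integral>\<^sup>+ y. ennreal (avoid2 d x y ^ card A * (1 - dom_prob d y) ^ card B) \<partial>?N)"
    proof (intro nn_integral_cong)
      fix y assume y: "y \<in> space ?N"
      have "(\<integral>\<^sup>+ z. (\<Prod>l\<in>J. G l x y (z l)) \<partial>PiM J (\<lambda>_. ?N)) = (\<Prod>l\<in>J. \<integral>\<^sup>+ w. G l x y w \<partial>?N)"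
        using J(1) by (rule P.product_nn_integral_prod) (use x y in \<open>auto intro!: Gm\<close>)
      also have "\<dots> = (\<Prod>l\<in>J. ennreal (h l x y))"
        by (simp add: Gint x y)
      also have "\<dots> = ennreal (\<Prod>l\<in>J. h l x y)"
        using dom_prob_le_1 avoid2_nonneg by (intro prod_ennreal) (auto simp: h_def)
      also have "(\<Prod>l\<in>J. h l x y) = (\<Prod>l\<in>A. h l x y) * (\<Prod>l\<in>B. h l x y)"
        unfolding J_def using assms by (intro prod.union_disjoint) auto
      also have "(\<Prod>l\<in>B. h l x y) = (1 - dom_prob d y) ^ card B"
        using assms(3) by (subst prod.cong[OF refl, where h = "\<lambda>_. 1 - dom_prob d y"]) (auto simp: h_def)
      also have "(\<Prod>l\<in>A. h l x y) = avoid2 d x y ^ card A"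
        by (simp add: h_def)
      finally show "(\<integral>\<^sup>+ z. (\<Prod>l\<in>J. G l x y (z l)) \<partial>PiM J (\<lambda>_. ?N))
          = ennreal (avoid2 d x y ^ card A * (1 - dom_prob d y) ^ card B)" .
    qed
    finally show "(\<integral>\<^sup>+ z. F (z(i := x)) \<partial>PiM (insert k J) (\<lambda>_. ?N))
        = (\<integral>\<^sup>+ y. ennreal (avoid2 d x y ^ card A * (1 - dom_prob d y) ^ card B) \<partial>?N)" .
  qed
  also have "\<dots> = (\<integral>\<^sup>+ z. ennreal (avoid2 d (fst z) (snd z) ^ card A * (1 - dom_prob d (snd z)) ^ card B) \<partial>pair_expo d)"
  proof -
    have "(\<lambda>z. ennreal (avoid2 d (fst z) (snd z) ^ card A * (1 - dom_prob d (snd z)) ^ card B)) \<in> borel_measurable (pair_expo d)"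
      by measurable
    from nn_integral_pair_expo(1)[OF this] show ?thesis by simp
  qed
  also have "\<dots> = ennreal (\<integral>z. avoid2 d (fst z) (snd z) ^ card A * (1 - dom_prob d (snd z)) ^ card B \<partial>pair_expo d)"
  proof (intro nn_integral_eq_integral integrable_pair_expo[where B = 1] AE_I2)
    fix z :: "(nat \<Rightarrow> real) \<times> (nat \<Rightarrow> real)"
    have "avoid2 d (fst z) (snd z) \<le> 1"
      using avoid2_le(1)[of d "fst z" "snd z"] dom_prob_pos[of d "fst z"] by simp
    then have "0 \<le> avoid2 d (fst z) (snd z) ^ card A * (1 - dom_prob d (snd z)) ^ card B"
      "avoid2 d (fst z) (snd z) ^ card A * (1 - dom_prob d (snd z)) ^ card B \<le> 1"
      using dom_prob_pos[of d "snd z"] dom_prob_le_1[of d "snd z"] avoid2_nonneg[of d "fst z" "snd z"]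
      by (auto intro!: mult_le_one power_le_one)
    then show "\<bar>avoid2 d (fst z) (snd z) ^ card A * (1 - dom_prob d (snd z)) ^ card B\<bar> \<le> 1"
      "0 \<le> avoid2 d (fst z) (snd z) ^ card A * (1 - dom_prob d (snd z)) ^ card B" by auto
  qed measurable
  finally show ?thesis
    using avoid2_nonneg dom_prob_le_1
    by (subst (asm) ennreal_inj) (auto intro!: Bochner_Integration.integral_nonneg mult_nonneg_nonneg)
qed

text \<open>The pair formula with a dummy observation i on which no condition is placed. The index 0
  is excluded because observations are numbered from 1.\<close>

lemma prob_avoid:
  assumes "finite B" "k \<notin> B" "k \<ge> 1" "B \<subseteq> {1..}"
  shows "prob {\<omega> \<in> space M. \<forall>l\<in>B. \<not> dominated k l \<omega>} = iter_mean d (card B)"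
proof -
  obtain i where i: "i \<notin> insert 0 (insert k B)"
    using ex_new_if_finite[of "insert 0 (insert k B)"] assms(1) by auto
  have "prob {\<omega> \<in> space M. \<forall>l\<in>B. \<not> dominated k l \<omega>}
      = (\<integral>z. (1 - dom_prob d (fst z)) ^ 0 * (1 - dom_prob d (snd z)) ^ card B \<partial>pair_expo d)"
    using prob_avoid_pair[of "{}" B i k] assms i by auto
  also have "\<dots> = iter_mean d 0 * iter_mean d (card B)"
    by (rule integral_pair_expo_product)
  also have "iter_mean d 0 = 1"
    by (induction d) auto
  finally show ?thesis by simp
qed

end

section \<open>Variance bounds\<close>

text \<open>The terms \<open>q * (1 - q) ^ t\<close> decrease in t and those with t <= j sum to at
  most 1, so j + 1 copies of the last one do as well.\<close>

lemma mult_power_le_inverse: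
  fixes q :: real
  assumes "0 \<le> q" "q \<le> 1"
  shows "q * (1 - q) ^ j \<le> 1 / (real j + 1)"
proof -
  have "(real j + 1) * (q * (1 - q) ^ j) = (\<Sum>t\<le>j. q * (1 - q) ^ j)"
    by simp
  also have "\<dots> \<le> (\<Sum>t\<le>j. q * (1 - q) ^ t)"
    using assms by (intro sum_mono mult_left_mono power_decreasing) auto
  also have "\<dots> = 1 - (1 - q) ^ Suc j"
    using one_diff_power_eq[of "1 - q" "Suc j"] by (simp add: sum_distrib_left lessThan_Suc_atMost)
  also have "\<dots> \<le> 1"
    using assms zero_le_power[of "1 - q" "Suc j"] by linarith
  finally show ?thesis by (simp add: field_simps)
qed

text \<open>As A <= min a b, its square is at most a b. This separates the dependence on x and y at
  the price of half the exponent; \<open>m div 2\<close> avoids roots.\<close>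

lemma power_le_geometric_mean:
  fixes A a b :: real
  assumes "0 \<le> A" "A \<le> a" "A \<le> b" "A \<le> 1"
  shows "A ^ m \<le> (a * b) ^ (m div 2)"
proof -
  have "A ^ m \<le> A ^ (2 * (m div 2))"
    using assms by (intro power_decreasing) auto
  also have "\<dots> = (A * A) ^ (m div 2)"
    by (simp add: power_mult power2_eq_square)
  also have "\<dots> \<le> (a * b) ^ (m div 2)"
    using assms by (intro power_mono mult_mono) auto
  finally show ?thesis .
qed

text \<open>In the following pointwise estimates p, q and s stand for the probabilities that an observation
  dominates x, y and both; A is the probability that it dominates neither.\<close>
lemma avoid_power_diff:
  fixes p q s A a b :: real
  assumes p: "0 < p" "p \<le> 1" and q: "0 < q" "q \<le> 1" and s: "p * q \<le> s" "s \<le> p" "s \<le> q"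
    and A: "A = 1 - p - q + s" "0 \<le> A" and ab: "a = 1 - p" "b = 1 - q"
  shows "0 \<le> A ^ m - (a * b) ^ m" "A ^ m - (a * b) ^ m \<le> real m * s * (a * b) ^ ((m - 1) div 2)"
proof -
  have abeq: "a * b = 1 - p - q + p * q" by (simp add: ab algebra_simps)
  have le: "0 \<le> a * b" "a * b \<le> A"
    using ab p q by (simp add: mult_nonneg_nonneg, use s A abeq in simp)
  have "0 \<le> p * q" using p q by simp
  with abeq A have As: "A - a * b \<le> s" by simp
  have s0: "0 \<le> s" using \<open>0 \<le> p * q\<close> s by linarith
  from le show "0 \<le> A ^ m - (a * b) ^ m" by (simp add: power_mono)
  show "A ^ m - (a * b) ^ m \<le> real m * s * (a * b) ^ ((m - 1) div 2)"
  proof (cases m)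
    case (Suc k)
    \<comment> \<open>\<open>A - a * b\<close> is \<open>s - p * q\<close>, the covariance of
      missing x and missing y for one observation. The mean value bound extracts it as a factor, at
      most s.\<close>
    have "A ^ Suc k - (a * b) ^ Suc k \<le> (A - a * b) * (real (Suc k) * A ^ k)"
      by (rule power_diff_le_deriv[OF le])
    also have "\<dots> \<le> s * (real (Suc k) * (a * b) ^ (k div 2))"
    proof (intro mult_mono mult_left_mono power_le_geometric_mean)
      show "A - a * b \<le> s" by (rule As)
    qed (use assms s0 in auto)
    finally show ?thesis by (simp add: Suc mult_ac)
  qed simp
qed

text \<open>Summing over later records yields a geometric series in b, at most 1 / q, which turns s
  into the conditional probability s / q. The exponent m + 1 + t exceeds m + t because the bound on
  the joint event ignores the comparison of the two candidates; this costs
  \<open>(a * b) ^ m * (q * b ^ t)\<close>, which also sums geometrically.\<close>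

lemma record_covariance_pointwise:
  fixes p q s A a b :: real
  assumes p: "0 < p" "p \<le> 1" and q: "0 < q" "q \<le> 1" and s: "p * q \<le> s" "s \<le> p" "s \<le> q"
    and A: "A = 1 - p - q + s" "0 \<le> A" and ab: "a = 1 - p" "b = 1 - q"
  shows "(\<Sum>t<N. A ^ m * b ^ t - a ^ m * b ^ (m + 1 + t)) \<le> real m * (s / q * (a * b) ^ ((m - 1) div 2)) + a ^ m"
proof -
  have ab01: "0 \<le> a" "a \<le> 1" "0 \<le> b" "b \<le> 1" using assms by auto
  have qb: "q = 1 - b" using ab by simp
  have geo: "q * (\<Sum>t<N. b ^ t) = 1 - b ^ N"
    using one_diff_power_eq[of b N] ab by simp
  have geo1: "q * (\<Sum>t<N. b ^ t) \<le> 1"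
    unfolding geo using ab01 by simp
  then have geo2: "(\<Sum>t<N. b ^ t) \<le> 1 / q" using q by (simp add: field_simps)
  have S0: "0 \<le> (\<Sum>t<N. b ^ t)" using ab01 by (intro sum_nonneg) auto
  have "(\<Sum>t<N. A ^ m * b ^ t - a ^ m * b ^ (m + 1 + t))
      = (\<Sum>t<N. (A ^ m - (a * b) ^ m) * b ^ t + (a * b) ^ m * (q * b ^ t))"
    by (intro sum.cong) (auto simp: qb power_mult_distrib power_add algebra_simps)
  also have "\<dots> = (A ^ m - (a * b) ^ m) * (\<Sum>t<N. b ^ t) + (a * b) ^ m * (q * (\<Sum>t<N. b ^ t))"
    by (simp add: sum.distrib sum_distrib_left)
  also have "\<dots> \<le> (real m * s * (a * b) ^ ((m - 1) div 2)) * (1 / q) + a ^ m * 1"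
  proof (intro add_mono mult_mono geo1 geo2)
    show "A ^ m - (a * b) ^ m \<le> real m * s * (a * b) ^ ((m - 1) div 2)"
      by (rule avoid_power_diff(2)[OF assms])
    show "(a * b) ^ m \<le> a ^ m"
      using ab01 by (intro power_mono mult_left_le mult_nonneg_nonneg) auto
    have "0 \<le> p * q" using p q by simp
    with s have "0 \<le> s" by linarith
    with ab01 show "0 \<le> real m * s * (a * b) ^ ((m - 1) div 2)" by auto
  qed (use S0 q ab01 in auto)
  finally show ?thesis by (simp add: mult_ac)
qed

text \<open>No sum over later observations supplies 1 / q here. Instead s = (s / q) q, and q is
  absorbed by part of the power of b through \<open>mult_power_le_inverse\<close>; halving the
  exponent once more for this gives \<open>(m - 1) div 4\<close>. The ignored mutual comparison
  costs 1 - a b <= p + q, absorbed the same way.\<close>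

lemma current_covariance_pointwise:
  fixes p q s A a b :: real
  assumes p: "0 < p" "p \<le> 1" and q: "0 < q" "q \<le> 1" and s: "p * q \<le> s" "s \<le> p" "s \<le> q"
    and A: "A = 1 - p - q + s" "0 \<le> A" and ab: "a = 1 - p" "b = 1 - q"
  shows "A ^ m - a ^ (m + 1) * b ^ (m + 1)
    \<le> real m / (real ((m - 1) div 4) + 1) * (s / q * (a * b) ^ ((m - 1) div 4)) + (a ^ m + b ^ m) / (real m + 1)"
proof -
  have ab01: "0 \<le> a" "a \<le> 1" "0 \<le> b" "b \<le> 1" using assms by auto
  have "0 \<le> p * q" using p q by simp
  with s have s0: "0 \<le> s" by linarith
  define j where "j = (m - 1) div 4"
  have j: "2 * j \<le> (m - 1) div 2" by (simp add: j_def)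
  have "A ^ m - a ^ (m + 1) * b ^ (m + 1) = (A ^ m - (a * b) ^ m) + (a * b) ^ m * (1 - a * b)"
    by (simp add: algebra_simps power_mult_distrib)
  also have "A ^ m - (a * b) ^ m \<le> real m * s * (a * b) ^ ((m - 1) div 2)"
    by (rule avoid_power_diff(2)[OF assms])
  also have "(a * b) ^ ((m - 1) div 2) \<le> (a * b) ^ (2 * j)"
    using ab01 j by (intro power_decreasing mult_le_one) auto
  then have "real m * s * (a * b) ^ ((m - 1) div 2) \<le> real m * s * (a * b) ^ (2 * j)"
    using s0 by (intro mult_left_mono) auto
  also have "\<dots> = real m * (s / q) * (a * b) ^ j * (a ^ j * (q * (1 - q) ^ j))"
    using q by (simp add: mult_2 power_add power_mult_distrib ab)
  also have "\<dots> \<le> real m * (s / q) * (a * b) ^ j * (1 * (1 / (real j + 1)))"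
    using ab01 s0 q by (intro mult_left_mono mult_mono mult_power_le_inverse power_le_one) auto
  also have "(a * b) ^ m * (1 - a * b) \<le> (a * b) ^ m * (p + q)"
  proof (intro mult_left_mono)
    have "1 - a * b = p + q - p * q" by (simp add: ab algebra_simps)
    with \<open>0 \<le> p * q\<close> show "1 - a * b \<le> p + q" by simp
  qed (use ab01 in auto)
  also have "\<dots> = b ^ m * (p * a ^ m) + a ^ m * (q * b ^ m)"
    by (simp add: power_mult_distrib algebra_simps)
  also have "\<dots> \<le> b ^ m * (1 / (real m + 1)) + a ^ m * (1 / (real m + 1))"
    using ab01 p q mult_power_le_inverse[of p m] mult_power_le_inverse[of q m]
    by (intro add_mono mult_left_mono) (auto simp: ab)
  finally show ?thesis by (simp add: j_def add_divide_distrib mult_ac add_ac)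
qed

lemma (in prob_space) variance_sum_indicator:
  assumes "finite K" and E: "\<And>k. k \<in> K \<Longrightarrow> E k \<in> events"
  shows "variance (\<lambda>\<omega>. \<Sum>k\<in>K. indicator (E k) \<omega>)
    = (\<Sum>i\<in>K. \<Sum>k\<in>K. prob (E i \<inter> E k) - prob (E i) * prob (E k))"
proof -
  let ?X = "\<lambda>\<omega>. \<Sum>k\<in>K. indicator (E k) \<omega> :: real"
  have sq: "(?X \<omega>)\<^sup>2 = (\<Sum>i\<in>K. \<Sum>k\<in>K. indicator (E i \<inter> E k) \<omega>)" for \<omega>
    by (simp add: power2_eq_square sum_product indicator_inter_arith)
  have int: "integrable M (indicator (E i) :: _ \<Rightarrow> real)" "integrable M (indicator (E i \<inter> E k) :: _ \<Rightarrow> real)"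
    if "i \<in> K" "k \<in> K" for i k
    using E that by (auto intro!: integrable_real_indicator simp: emeasure_eq_measure)
  have X: "integrable M ?X" using int by (intro Bochner_Integration.integrable_sum)
  have X2: "integrable M (\<lambda>\<omega>. (?X \<omega>)\<^sup>2)"
    unfolding sq using int by (intro Bochner_Integration.integrable_sum)
  have "expectation ?X = (\<Sum>k\<in>K. prob (E k))"
    using int E by (subst Bochner_Integration.integral_sum) (auto intro!: sum.cong)
  moreover have "expectation (\<lambda>\<omega>. (?X \<omega>)\<^sup>2) = (\<Sum>i\<in>K. \<Sum>k\<in>K. prob (E i \<inter> E k))"
    unfolding sq using int E by (simp add: Bochner_Integration.integral_sum)
  ultimately show ?thesis
    unfolding variance_eq[OF X X2] by (simp add: power2_eq_square sum_product sum_subtractf)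
qed

text \<open>The upper triangle is indexed by the gap t, the summation index of the geometric series
  in \<open>record_covariance_pointwise\<close>.\<close>

lemma sum_symmetric_triangle:
  fixes c :: "nat \<Rightarrow> nat \<Rightarrow> real"
  assumes "\<And>i k. c i k = c k i"
  shows "(\<Sum>i<n. \<Sum>k<n. c i k) = (\<Sum>i<n. c i i) + 2 * (\<Sum>i<n. \<Sum>t<n - i - 1. c i (i + 1 + t))"
proof (induction n)
  case 0
  show ?case by simp
next
  case (Suc n)
  have "(\<Sum>t<Suc n - i - 1. c i (i + 1 + t)) = (\<Sum>t<n - i - 1. c i (i + 1 + t)) + c i n" if "i < n" for i
  proof -
    have "Suc n - i - 1 = Suc (n - i - 1)" "i + 1 + (n - i - 1) = n" using that by auto
    then show ?thesis by simp
  qed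
  then have "(\<Sum>i<n. \<Sum>t<Suc n - i - 1. c i (i + 1 + t)) = (\<Sum>i<n. \<Sum>t<n - i - 1. c i (i + 1 + t)) + (\<Sum>i<n. c i n)"
    by (simp add: sum.distrib del: diff_Suc_1')
  moreover have "(\<Sum>k<n. c n k) = (\<Sum>k<n. c k n)" using assms by simp
  ultimately show ?case using Suc by (simp add: sum.distrib)
qed

lemma iter_mean_Suc_eq: "(real m + 1) * iter_mean (Suc d) m = (\<Sum>i<Suc m. iter_mean d i)"
  by (simp add: lessThan_Suc_atMost)

lemma dom_prob_facts:
  "0 < dom_prob d x" "dom_prob d x \<le> 1" "0 < dom_prob d y" "dom_prob d y \<le> 1"
  "dom_prob d x * dom_prob d y \<le> dom_prob2 d x y" "dom_prob2 d x y \<le> dom_prob d x" "dom_prob2 d x y \<le> dom_prob d y"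
  "avoid2 d x y = 1 - dom_prob d x - dom_prob d y + dom_prob2 d x y" "0 \<le> avoid2 d x y"
  by (simp_all add: dom_prob_pos dom_prob_le_1 dom_prob_mult_le dom_prob2_le avoid2_def avoid2_nonneg[unfolded avoid2_def])

lemma integrable_pair_expo_powers:
  "integrable (pair_expo d) (\<lambda>z. avoid2 d (fst z) (snd z) ^ k * (1 - dom_prob d (fst z)) ^ m * (1 - dom_prob d (snd z)) ^ n)"
  "integrable (pair_expo d) (\<lambda>z. dom_ratio d (fst z) (snd z) * ((1 - dom_prob d (fst z)) * (1 - dom_prob d (snd z))) ^ m)"
proof -
  have *: "\<bar>1 - dom_prob d x\<bar> \<le> 1" "\<bar>avoid2 d x y\<bar> \<le> 1" "\<bar>dom_ratio d x y\<bar> \<le> 1" for x y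
    using dom_prob_pos[of d x] dom_prob_le_1[of d x] avoid2_nonneg[of d x y] avoid2_le(1)[of d x y] dom_ratio_nonneg[of d x y] dom_ratio_le_1[of d x y] by auto
  show "integrable (pair_expo d) (\<lambda>z. avoid2 d (fst z) (snd z) ^ k * (1 - dom_prob d (fst z)) ^ m * (1 - dom_prob d (snd z)) ^ n)"
    by (intro integrable_pair_expo[where B = 1])
      (measurable, auto simp: abs_mult power_abs intro!: mult_le_one power_le_one *)
  show "integrable (pair_expo d) (\<lambda>z. dom_ratio d (fst z) (snd z) * ((1 - dom_prob d (fst z)) * (1 - dom_prob d (snd z))) ^ m)"
    by (intro integrable_pair_expo[where B = 1])
      (measurable, auto simp: abs_mult power_abs intro!: mult_le_one power_le_one *)
qed

lemma integral_pair_expo_single: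
  "(\<integral>z. (1 - dom_prob d (fst z)) ^ m \<partial>pair_expo d) = iter_mean d m"
  "(\<integral>z. (1 - dom_prob d (snd z)) ^ m \<partial>pair_expo d) = iter_mean d m"
proof -
  have "iter_mean d 0 = 1" by (induction d) auto
  then show "(\<integral>z. (1 - dom_prob d (fst z)) ^ m \<partial>pair_expo d) = iter_mean d m"
    "(\<integral>z. (1 - dom_prob d (snd z)) ^ m \<partial>pair_expo d) = iter_mean d m"
    using integral_pair_expo_product[of d m 0] integral_pair_expo_product[of d 0 m] by simp_all
qed

section \<open>Means and variances of the numbers of records and current records\<close>

context iid_exponentials
begin

definition record_event :: "nat \<Rightarrow> 'a set" where
  "record_event k = {\<omega> \<in> space M. \<forall>l\<in>{1..<k}. \<not> dominated k l \<omega>}"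

text \<open>The index k is left out because \<open>prob_avoid\<close> needs it outside the compared
  set. Since d >= 1, no point strictly dominates itself, so the event is the same; see
  \<open>currents_eq\<close>.\<close>

definition current_event :: "nat \<Rightarrow> nat \<Rightarrow> 'a set" where
  "current_event n k = {\<omega> \<in> space M. \<forall>l\<in>{1..n} - {k}. \<not> dominated k l \<omega>}"

lemma record_event_measurable: "k \<ge> 1 \<Longrightarrow> record_event k \<in> events"
proof -
  assume "k \<ge> 1"
  then have "Measurable.pred M (\<lambda>\<omega>. \<forall>l\<in>{1..<k}. \<not> dominated k l \<omega>)"
    by (intro pred_intros_logic pred_intros_finite(3) measurable_dominated) auto
  then show ?thesis by (simp add: record_event_def)
qed

lemma current_event_measurable: "k \<ge> 1 \<Longrightarrow> current_event n k \<in> events"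
proof -
  assume "k \<ge> 1"
  then have "Measurable.pred M (\<lambda>\<omega>. \<forall>l\<in>{1..n} - {k}. \<not> dominated k l \<omega>)"
    by (intro pred_intros_logic pred_intros_finite(3) measurable_dominated) auto
  then show ?thesis by (simp add: current_event_def)
qed

lemma prob_record_event: "prob (record_event (Suc m)) = iter_mean d m"
  unfolding record_event_def by (subst prob_avoid) auto

lemma prob_current_event: "k \<in> {1..n} \<Longrightarrow> prob (current_event n k) = iter_mean d (n - 1)"
  unfolding current_event_def by (subst prob_avoid) auto

definition records :: "nat \<Rightarrow> 'a \<Rightarrow> real" where
  "records n \<omega> = real (num_records d (\<lambda>k j. Y k j \<omega>) n)"

definition currents :: "nat \<Rightarrow> 'a \<Rightarrow> real" where
  "currents n \<omega> = real (num_current_records d (\<lambda>k j. Y k j \<omega>) n)"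

lemma records_eq:
  assumes "\<omega> \<in> space M"
  shows "records n \<omega> = (\<Sum>m<n. indicator (record_event (Suc m)) \<omega>)"
proof -
  have "records n \<omega> = (\<Sum>k\<in>{1..n}. indicator (record_event k) \<omega>)"
    using assms unfolding records_def num_records_def record_event_def
    by (simp add: indicator_def sum.If_cases Int_def conj_commute)
  also have "\<dots> = (\<Sum>m<n. indicator (record_event (Suc m)) \<omega>)"
    by (rule sum.reindex_bij_witness[of _ Suc "\<lambda>k. k - 1"]) auto
  finally show ?thesis .
qed

lemma currents_eq:
  assumes "\<omega> \<in> space M"
  shows "currents n \<omega> = (\<Sum>k\<in>{1..n}. indicator (current_event n k) \<omega>)"
proof -
  have "\<not> dominated k k \<omega>" for k
    using dim_pos by (auto simp: strictly_dominated_def intro!: exI[of _ 0])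
  then have *: "(\<forall>l\<in>{1..n}. \<not> dominated k l \<omega>) \<longleftrightarrow> (\<forall>l\<in>{1..n} - {k}. \<not> dominated k l \<omega>)" for k
    by auto
  show ?thesis
    using assms unfolding currents_def num_current_records_def current_event_def *
    by (simp add: indicator_def sum.If_cases Int_def conj_commute)
qed

lemma expectation_records: "expectation (records n) = (\<Sum>i<n. iter_mean d i)"
proof -
  have "expectation (records n) = expectation (\<lambda>\<omega>. \<Sum>m<n. indicator (record_event (Suc m)) \<omega>)"
    by (intro Bochner_Integration.integral_cong) (auto simp: records_eq)
  also have "\<dots> = (\<Sum>m<n. prob (record_event (Suc m)))"
    by (subst Bochner_Integration.integral_sum)
      (auto simp: record_event_measurable emeasure_eq_measure intro!: integrable_real_indicator)
  finally show ?thesis by (simp add: prob_record_event)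
qed

text \<open>The mean number of current records in dimension d is the mean number of records in dimension
  d - 1; in particular it is nondecreasing in n.\<close>
lemma expectation_currents: "expectation (currents n) = (\<Sum>i<n. iter_mean (d - 1) i)"
proof -
  have "expectation (currents n) = expectation (\<lambda>\<omega>. \<Sum>k\<in>{1..n}. indicator (current_event n k) \<omega>)"
    by (intro Bochner_Integration.integral_cong) (auto simp: currents_eq)
  also have "\<dots> = (\<Sum>k\<in>{1..n}. prob (current_event n k))"
    by (subst Bochner_Integration.integral_sum)
      (auto simp: current_event_measurable emeasure_eq_measure intro!: integrable_real_indicator)
  also have "\<dots> = real n * iter_mean d (n - 1)"
    by (simp add: prob_current_event)
  also have "\<dots> = (\<Sum>i<n. iter_mean (d - 1) i)"
    using iter_mean_Suc_eq[of "n - 1" "d - 1"] dim_pos by (cases n) (simp_all add: add.commute)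
  finally show ?thesis .
qed

text \<open>Uniform in N, so all later records are charged to record m + 1. The sum is moved under
  the integral before estimating, where it becomes a geometric series.\<close>

lemma record_covariance_sum:
  "(\<Sum>t<N. prob (record_event (Suc m) \<inter> record_event (Suc (m + 1 + t)))
      - prob (record_event (Suc m)) * prob (record_event (Suc (m + 1 + t))))
    \<le> 64 * 8 ^ d * (1 + ln (real m + 1)) ^ (d - 1) / (real m + 1) + iter_mean d m"
proof -
  let ?A = "\<lambda>z. avoid2 d (fst z) (snd z)" and ?a = "\<lambda>z. 1 - dom_prob d (fst z)" and ?b = "\<lambda>z. 1 - dom_prob d (snd z)"
  let ?r = "\<lambda>z. dom_ratio d (fst z) (snd z)"
  let ?j = "(m - 1) div 2"
  have int1: "integrable (pair_expo d) (\<lambda>z. ?A z ^ m * ?b z ^ t)" for t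
    using integrable_pair_expo_powers(1)[of d m 0 t] by simp
  have int2: "integrable (pair_expo d) (\<lambda>z. ?a z ^ m * ?b z ^ (m + 1 + t))" for t
    using integrable_pair_expo_powers(1)[of d 0 m "m + 1 + t"] by simp
  have int3: "integrable (pair_expo d) (\<lambda>z. ?r z * (?a z * ?b z) ^ ?j)"
    by (rule integrable_pair_expo_powers(2))
  have int4: "integrable (pair_expo d) (\<lambda>z. ?a z ^ m)"
    using integrable_pair_expo_powers(1)[of d 0 m 0] by simp
  \<comment> \<open>The comparison between the two candidates is dropped; m observations precede
    both and t lie between them.\<close>
  have "prob (record_event (Suc m) \<inter> record_event (Suc (m + 1 + t))) \<le> (\<integral>z. ?A z ^ m * ?b z ^ t \<partial>pair_expo d)" for t
  proof -
    let ?S = "{\<omega> \<in> space M. (\<forall>l\<in>{1..m}. \<not> dominated (Suc m) l \<omega> \<and> \<not> dominated (Suc (m + 1 + t)) l \<omega>)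
        \<and> (\<forall>l\<in>{Suc m<..<Suc (m + 1 + t)}. \<not> dominated (Suc (m + 1 + t)) l \<omega>)}"
    have "?S \<in> events"
    proof -
      have "Measurable.pred M (\<lambda>\<omega>. (\<forall>l\<in>{1..m}. \<not> dominated (Suc m) l \<omega> \<and> \<not> dominated (Suc (m + 1 + t)) l \<omega>)
        \<and> (\<forall>l\<in>{Suc m<..<Suc (m + 1 + t)}. \<not> dominated (Suc (m + 1 + t)) l \<omega>))"
        by (intro pred_intros_logic pred_intros_finite(3) measurable_dominated) auto
      then show ?thesis by simp
    qed
    then have "prob (record_event (Suc m) \<inter> record_event (Suc (m + 1 + t))) \<le> prob ?S"
      by (intro finite_measure_mono) (auto simp: record_event_def)
    also have "\<dots> = (\<integral>z. ?A z ^ card {1..m} * ?b z ^ card {Suc m<..<Suc (m + 1 + t)} \<partial>pair_expo d)"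
      by (rule prob_avoid_pair) auto
    finally show ?thesis by simp
  qed
  then have "(\<Sum>t<N. prob (record_event (Suc m) \<inter> record_event (Suc (m + 1 + t)))
      - prob (record_event (Suc m)) * prob (record_event (Suc (m + 1 + t))))
    \<le> (\<Sum>t<N. (\<integral>z. ?A z ^ m * ?b z ^ t \<partial>pair_expo d) - (\<integral>z. ?a z ^ m * ?b z ^ (m + 1 + t) \<partial>pair_expo d))"
    unfolding integral_pair_expo_product prob_record_event by (intro sum_mono diff_right_mono) auto
  also have "\<dots> = (\<integral>z. (\<Sum>t<N. ?A z ^ m * ?b z ^ t - ?a z ^ m * ?b z ^ (m + 1 + t)) \<partial>pair_expo d)"
    unfolding Bochner_Integration.integral_diff[OF int1 int2, symmetric]
    by (rule Bochner_Integration.integral_sum[symmetric]) (intro Bochner_Integration.integrable_diff int1 int2)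
  also have "\<dots> \<le> (\<integral>z. real m * (?r z * (?a z * ?b z) ^ ?j) + ?a z ^ m \<partial>pair_expo d)"
  proof (intro integral_mono Bochner_Integration.integrable_sum Bochner_Integration.integrable_diff
      Bochner_Integration.integrable_add integrable_mult_right int1 int2 int3 int4)
    fix z
    show "(\<Sum>t<N. ?A z ^ m * ?b z ^ t - ?a z ^ m * ?b z ^ (m + 1 + t)) \<le> real m * (?r z * (?a z * ?b z) ^ ?j) + ?a z ^ m"
      unfolding dom_ratio_def by (rule record_covariance_pointwise[OF dom_prob_facts]) auto
  qed
  also have "\<dots> = real m * (\<integral>z. ?r z * (?a z * ?b z) ^ ?j \<partial>pair_expo d) + iter_mean d m"
    using int3 int4 by (simp add: integral_pair_expo_single)
  also have "real m * (\<integral>z. ?r z * (?a z * ?b z) ^ ?j \<partial>pair_expo d)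
      \<le> 64 * 8 ^ d * (1 + ln (real m + 1)) ^ (d - 1) / (real m + 1)"
  proof (cases "m = 0")
    case False
    let ?L = "(1 + ln (real m + 1)) ^ (d - 1)"
    \<comment> \<open>Halving the exponent costs a factor 4 in the pair moment, and the factor
      \<open>real m\<close> uses up one of its two inverse powers of m.\<close>
    have j: "2 * (?j + 1) \<ge> m" "?j \<le> m" using False by auto
    have j': "real m / 2 \<le> real ?j + 1" using of_nat_mono[OF j(1), where ?'a = real] by simp
    have "(\<integral>z. ?r z * (?a z * ?b z) ^ ?j \<partial>pair_expo d) \<le> 4 * 8 ^ d * (1 + ln (real ?j + 1)) ^ (d - 1) / (real ?j + 1)\<^sup>2"
      by (rule integral_pair_moment[OF dim_pos])
    also have "\<dots> \<le> 4 * 8 ^ d * ?L / (real m / 2)\<^sup>2"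
      using j j' False by (intro frac_le mult_left_mono power_mono mult_nonneg_nonneg) auto
    also have "\<dots> = 16 * 8 ^ d * ?L / (real m)\<^sup>2"
      by (simp add: power_divide)
    finally have "real m * (\<integral>z. ?r z * (?a z * ?b z) ^ ?j \<partial>pair_expo d) \<le> real m * (16 * 8 ^ d * ?L / (real m)\<^sup>2)"
      by (intro mult_left_mono) auto
    also have "\<dots> = 32 * 8 ^ d * ?L / (2 * real m)"
      using False by (simp add: power2_eq_square)
    also have "\<dots> \<le> 64 * 8 ^ d * ?L / (real m + 1)"
      using False by (intro frac_le mult_right_mono) auto
    finally show ?thesis .
  qed simp
  finally show ?thesis by simp
qed

text \<open>Diagonal terms are at most the means; off the diagonal, \<open>(ln i)^(d-1) / i\<close>
  sums harmonically to the last logarithm. The constants are 3 = 1 + 2 and 128 = 2 * 64, the factors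
  2 coming from symmetry.\<close>

lemma variance_records:
  assumes "n \<ge> 1"
  shows "variance (records n) \<le> (3 + 128 * 8 ^ d) * (1 + ln (real n)) ^ d"
proof -
  let ?c = "\<lambda>i k. prob (record_event (Suc i) \<inter> record_event (Suc k)) - prob (record_event (Suc i)) * prob (record_event (Suc k))"
  let ?L = "1 + ln (real n)"
  have eq: "expectation (records n) = expectation (\<lambda>\<omega>. \<Sum>m<n. indicator (record_event (Suc m)) \<omega>)"
    by (intro Bochner_Integration.integral_cong) (auto simp: records_eq)
  have "variance (records n) = variance (\<lambda>\<omega>. \<Sum>m<n. indicator (record_event (Suc m)) \<omega>)"
    unfolding eq by (intro Bochner_Integration.integral_cong) (auto simp: records_eq)
  also have "\<dots> = (\<Sum>i<n. \<Sum>k<n. ?c i k)"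
    by (rule variance_sum_indicator) (auto intro: record_event_measurable)
  also have "\<dots> = (\<Sum>i<n. ?c i i) + 2 * (\<Sum>i<n. \<Sum>t<n - i - 1. ?c i (i + 1 + t))"
    by (rule sum_symmetric_triangle) (simp add: Int_commute mult.commute)
  also have "\<dots> \<le> (\<Sum>i<n. iter_mean d i) + 2 * (\<Sum>i<n. 64 * 8 ^ d * ?L ^ (d - 1) * (1 / (real i + 1)) + iter_mean d i)"
  proof (intro add_mono sum_mono mult_left_mono)
    fix i assume "i \<in> {..<n}"
    then have i: "real i + 1 \<le> real n" by auto
    have "(\<Sum>t<n - i - 1. ?c i (i + 1 + t)) \<le> 64 * 8 ^ d * (1 + ln (real i + 1)) ^ (d - 1) / (real i + 1) + iter_mean d i"
      by (rule record_covariance_sum)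
    also have "64 * 8 ^ d * (1 + ln (real i + 1)) ^ (d - 1) / (real i + 1) \<le> 64 * 8 ^ d * ?L ^ (d - 1) / (real i + 1)"
      using i by (intro divide_right_mono mult_left_mono power_mono) auto
    finally show "(\<Sum>t<n - i - 1. ?c i (i + 1 + t)) \<le> 64 * 8 ^ d * ?L ^ (d - 1) * (1 / (real i + 1)) + iter_mean d i"
      by simp
  qed (auto simp: prob_record_event)
  also have "\<dots> = 3 * (\<Sum>i<n. iter_mean d i) + 128 * 8 ^ d * ?L ^ (d - 1) * (\<Sum>i<n. 1 / (real i + 1))"
    by (simp only: sum.distrib sum_distrib_left[symmetric]) (simp add: algebra_simps)
  also have "\<dots> \<le> 3 * ?L ^ d + 128 * 8 ^ d * ?L ^ (d - 1) * ?L"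
    using assms by (intro add_mono mult_left_mono sum_iter_mean_upper sum_inverse_le_ln mult_nonneg_nonneg zero_le_power) auto
  also have "\<dots> = (3 + 128 * 8 ^ d) * ?L ^ d"
    using dim_pos by (cases d) (simp_all add: algebra_simps)
  finally show ?thesis .
qed

text \<open>With n = m + 2 the factor in front is n (n - 1), the number of ordered pairs, so the
  off-diagonal part of the variance is \<open>O((ln n)^(d-1))\<close>.\<close>

lemma current_covariance:
  assumes "i \<in> {1..m + 2}" "k \<in> {1..m + 2}" "i \<noteq> k"
  shows "(real m + 2) * (real m + 1) * (prob (current_event (m + 2) i \<inter> current_event (m + 2) k)
      - prob (current_event (m + 2) i) * prob (current_event (m + 2) k))
    \<le> (1536 * 8 ^ d + 4) * (1 + ln (real m + 1)) ^ (d - 1)"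
proof -
  let ?A = "\<lambda>z. avoid2 d (fst z) (snd z)" and ?a = "\<lambda>z. 1 - dom_prob d (fst z)" and ?b = "\<lambda>z. 1 - dom_prob d (snd z)"
  let ?r = "\<lambda>z. dom_ratio d (fst z) (snd z)"
  let ?j = "(m - 1) div 4" and ?L = "(1 + ln (real m + 1)) ^ (d - 1)"
  have int1: "integrable (pair_expo d) (\<lambda>z. ?A z ^ m)"
    using integrable_pair_expo_powers(1)[of d m 0 0] by simp
  have int2: "integrable (pair_expo d) (\<lambda>z. ?a z ^ (m + 1) * ?b z ^ (m + 1))"
    using integrable_pair_expo_powers(1)[of d 0 "m + 1" "m + 1"] by simp
  have int3: "integrable (pair_expo d) (\<lambda>z. ?r z * (?a z * ?b z) ^ ?j)"
    by (rule integrable_pair_expo_powers(2))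
  have int4: "integrable (pair_expo d) (\<lambda>z. ?a z ^ m)" "integrable (pair_expo d) (\<lambda>z. ?b z ^ m)"
    using integrable_pair_expo_powers(1)[of d 0 m 0] integrable_pair_expo_powers(1)[of d 0 0 m] by simp_all
  have card: "card ({1..m + 2} - {i, k}) = m"
    using assms by (simp add: card_Diff_subset)
  have "prob (current_event (m + 2) i \<inter> current_event (m + 2) k) \<le> (\<integral>z. ?A z ^ m \<partial>pair_expo d)"
  proof -
    let ?S = "{\<omega> \<in> space M. (\<forall>l\<in>{1..m + 2} - {i, k}. \<not> dominated i l \<omega> \<and> \<not> dominated k l \<omega>)
        \<and> (\<forall>l\<in>{}. \<not> dominated k l \<omega>)}"
    have "?S \<in> events"
    proof -
      have "Measurable.pred M (\<lambda>\<omega>. \<forall>l\<in>{1..m + 2} - {i, k}. \<not> dominated i l \<omega> \<and> \<not> dominated k l \<omega>)"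
        using assms by (intro pred_intros_logic pred_intros_finite(3) measurable_dominated) auto
      then show ?thesis by simp
    qed
    then have "prob (current_event (m + 2) i \<inter> current_event (m + 2) k) \<le> prob ?S"
      by (intro finite_measure_mono) (auto simp: current_event_def)
    also have "\<dots> = (\<integral>z. ?A z ^ card ({1..m + 2} - {i, k}) * ?b z ^ card ({} :: nat set) \<partial>pair_expo d)"
      by (rule prob_avoid_pair) (use assms in auto)
    finally show ?thesis unfolding card by simp
  qed
  then have "prob (current_event (m + 2) i \<inter> current_event (m + 2) k)
      - prob (current_event (m + 2) i) * prob (current_event (m + 2) k)
    \<le> (\<integral>z. ?A z ^ m \<partial>pair_expo d) - (\<integral>z. ?a z ^ (m + 1) * ?b z ^ (m + 1) \<partial>pair_expo d)"
    unfolding integral_pair_expo_product using assms by (simp add: prob_current_event)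
  also have "\<dots> = (\<integral>z. ?A z ^ m - ?a z ^ (m + 1) * ?b z ^ (m + 1) \<partial>pair_expo d)"
    by (rule Bochner_Integration.integral_diff[OF int1 int2, symmetric])
  also have "\<dots> \<le> (\<integral>z. real m / (real ?j + 1) * (?r z * (?a z * ?b z) ^ ?j) + (?a z ^ m + ?b z ^ m) / (real m + 1) \<partial>pair_expo d)"
  proof (intro integral_mono Bochner_Integration.integrable_diff integrable_divide
      Bochner_Integration.integrable_add integrable_mult_right int1 int2 int3 int4)
    fix z
    show "?A z ^ m - ?a z ^ (m + 1) * ?b z ^ (m + 1)
      \<le> real m / (real ?j + 1) * (?r z * (?a z * ?b z) ^ ?j) + (?a z ^ m + ?b z ^ m) / (real m + 1)"
      unfolding dom_ratio_def by (rule current_covariance_pointwise[OF dom_prob_facts]) auto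
  qed
  also have "\<dots> = real m / (real ?j + 1) * (\<integral>z. ?r z * (?a z * ?b z) ^ ?j \<partial>pair_expo d) + 2 * iter_mean d m / (real m + 1)"
  proof -
    have "(\<integral>z. real m / (real ?j + 1) * (?r z * (?a z * ?b z) ^ ?j) + (?a z ^ m + ?b z ^ m) / (real m + 1) \<partial>pair_expo d)
      = (\<integral>z. real m / (real ?j + 1) * (?r z * (?a z * ?b z) ^ ?j) \<partial>pair_expo d)
        + (\<integral>z. (?a z ^ m + ?b z ^ m) / (real m + 1) \<partial>pair_expo d)"
      by (intro Bochner_Integration.integral_add integrable_divide
          Bochner_Integration.integrable_add integrable_mult_right int3 int4)
    also have "(\<integral>z. (?a z ^ m + ?b z ^ m) / (real m + 1) \<partial>pair_expo d) = 2 * iter_mean d m / (real m + 1)"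
      using int4 by (simp add: Bochner_Integration.integral_add integral_pair_expo_single)
    finally show ?thesis by simp
  qed
  finally have "(real m + 2) * (real m + 1) * (prob (current_event (m + 2) i \<inter> current_event (m + 2) k)
      - prob (current_event (m + 2) i) * prob (current_event (m + 2) k))
    \<le> (real m + 2) * (real m + 1) * (real m / (real ?j + 1) * (\<integral>z. ?r z * (?a z * ?b z) ^ ?j \<partial>pair_expo d)
        + 2 * iter_mean d m / (real m + 1))"
    by (intro mult_left_mono) auto
  also have "\<dots> = (real m + 2) * (real m + 1) * real m / (real ?j + 1) * (\<integral>z. ?r z * (?a z * ?b z) ^ ?j \<partial>pair_expo d)
      + 2 * (real m + 2) * iter_mean d m"
  proof -
    have "u * v * (x + 2 * y / v) = u * v * x + 2 * u * y" if "v \<noteq> 0" for u v x y :: real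
      using that by (simp add: field_simps)
    from this[of "real m + 1"] show ?thesis by simp
  qed
  also have "\<dots> \<le> 1536 * 8 ^ d * ?L + 4 * ?L"
  proof (rule add_mono)
    have "iter_mean d m \<le> ?L / (real m + 1)"
      using iter_mean_upper[of "d - 1" m] dim_pos by simp
    then have "2 * (real m + 2) * iter_mean d m \<le> 2 * (real m + 2) * (?L / (real m + 1))"
      by (intro mult_left_mono) auto
    also have "\<dots> = 2 * ((real m + 2) / (real m + 1)) * ?L" by simp
    also have "\<dots> \<le> 2 * 2 * ?L"
      by (intro mult_right_mono mult_left_mono) (auto simp: field_simps)
    finally show "2 * (real m + 2) * iter_mean d m \<le> 4 * ?L" by simp
  next
    show "(real m + 2) * (real m + 1) * real m / (real ?j + 1) * (\<integral>z. ?r z * (?a z * ?b z) ^ ?j \<partial>pair_expo d)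
        \<le> 1536 * 8 ^ d * ?L"
    proof (cases "m = 0")
      case False
      define J where "J = real ?j + 1"
      have j: "m \<le> 4 * (?j + 1)" "?j \<le> m" by auto
      have mJ: "real m \<le> 4 * J" unfolding J_def using of_nat_mono[OF j(1), where ?'a = real] by simp
      have J: "J \<ge> 1" by (simp add: J_def)
      \<comment> \<open>For m >= 1 and m <= 4 J: m + 2 <= 3 m <= 12 J and m + 1 <= 2 m <= 8 J.
        Multiplied by 4 from the pair moment, 384 becomes 1536.\<close>
      have "(real m + 2) * (real m + 1) * real m \<le> (3 * (4 * J)) * (2 * (4 * J)) * (4 * J)"
        using False mJ J by (intro mult_mono mult_nonneg_nonneg) auto
      also have "\<dots> = 384 * J ^ 3" by (simp add: power3_eq_cube)
      finally have m: "(real m + 2) * (real m + 1) * real m / J \<le> 384 * J ^ 3 / J"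
        using J by (intro divide_right_mono) auto
      have "(\<integral>z. ?r z * (?a z * ?b z) ^ ?j \<partial>pair_expo d) \<le> 4 * 8 ^ d * (1 + ln (real ?j + 1)) ^ (d - 1) / J\<^sup>2"
        unfolding J_def by (rule integral_pair_moment[OF dim_pos])
      also have "\<dots> \<le> 4 * 8 ^ d * ?L / J\<^sup>2"
        using j by (intro divide_right_mono mult_left_mono power_mono) auto
      finally have "(real m + 2) * (real m + 1) * real m / J * (\<integral>z. ?r z * (?a z * ?b z) ^ ?j \<partial>pair_expo d)
          \<le> (real m + 2) * (real m + 1) * real m / J * (4 * 8 ^ d * ?L / J\<^sup>2)"
        using J by (intro mult_left_mono) auto
      also have "\<dots> \<le> 384 * J ^ 3 / J * (4 * 8 ^ d * ?L / J\<^sup>2)"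
        using m J by (intro mult_right_mono) auto
      also have "\<dots> = 1536 * 8 ^ d * ?L"
        using J by (simp add: power3_eq_cube power2_eq_square)
      finally show ?thesis by (simp only: J_def)
    qed simp
  qed
  finally show ?thesis by (simp add: algebra_simps)
qed

text \<open>The covariances give \<open>O((ln n)^(d-1))\<close>; the power d is chosen to match
  \<open>variance_records\<close> when both enter the variance of the broken records.\<close>

lemma variance_currents:
  assumes "n \<ge> 1"
  shows "variance (currents n) \<le> (5 + 1536 * 8 ^ d) * (1 + ln (real n)) ^ d"
proof -
  let ?c = "\<lambda>i k. prob (current_event n i \<inter> current_event n k) - prob (current_event n i) * prob (current_event n k)"
  let ?L = "1 + ln (real n)" and ?K = "1536 * 8 ^ d + 4 :: real"
  have L: "?L \<ge> 1" using assms by simp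
  have eq: "expectation (currents n) = expectation (\<lambda>\<omega>. \<Sum>k\<in>{1..n}. indicator (current_event n k) \<omega>)"
    by (intro Bochner_Integration.integral_cong) (auto simp: currents_eq)
  have "variance (currents n) = variance (\<lambda>\<omega>. \<Sum>k\<in>{1..n}. indicator (current_event n k) \<omega>)"
    unfolding eq by (intro Bochner_Integration.integral_cong) (auto simp: currents_eq)
  also have "\<dots> = (\<Sum>i\<in>{1..n}. \<Sum>k\<in>{1..n}. ?c i k)"
    by (rule variance_sum_indicator) (auto intro: current_event_measurable)
  also have "\<dots> \<le> (\<Sum>i\<in>{1..n}. (?K + 1) * ?L ^ (d - 1) / real n)"
  proof (intro sum_mono)
    fix i assume i: "i \<in> {1..n}"
    have "?c i i \<le> iter_mean d (n - 1)"
      using prob_current_event[OF i] by simp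
    also have "\<dots> \<le> ?L ^ (d - 1) / real n"
      using iter_mean_upper[of "d - 1" "n - 1"] dim_pos assms by simp
    finally have diag: "?c i i \<le> ?L ^ (d - 1) / real n" .
    have off: "?c i k \<le> ?K * ?L ^ (d - 1) / (real n * (real n - 1))" if k: "k \<in> {1..n} - {i}" for k
    proof -
      have "n \<ge> 2" using i k by auto
      then obtain m where n: "n = m + 2" using le_Suc_ex by (metis add.commute)
      have "(real m + 2) * (real m + 1) * ?c i k \<le> ?K * (1 + ln (real m + 1)) ^ (d - 1)"
        using current_covariance[of i m k] i k unfolding n by auto
      also have "\<dots> \<le> ?K * ?L ^ (d - 1)"
        by (intro mult_left_mono power_mono) (auto simp: n)
      finally have "?c i k \<le> ?K * ?L ^ (d - 1) / ((real m + 2) * (real m + 1))"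
        by (subst pos_le_divide_eq) (simp_all only: mult.commute, auto)
      also have "(real m + 2) * (real m + 1) = real n * (real n - 1)"
        by (simp add: n add.commute)
      finally show ?thesis .
    qed
    have "(\<Sum>k\<in>{1..n}. ?c i k) = ?c i i + (\<Sum>k\<in>{1..n} - {i}. ?c i k)"
      using i by (intro sum.remove) auto
    also have "\<dots> \<le> ?L ^ (d - 1) / real n + (\<Sum>k\<in>{1..n} - {i}. ?K * ?L ^ (d - 1) / (real n * (real n - 1)))"
      by (intro add_mono diag sum_mono off)
    also have "(\<Sum>k\<in>{1..n} - {i}. ?K * ?L ^ (d - 1) / (real n * (real n - 1))) = (real n - 1) * (?K * ?L ^ (d - 1) / (real n * (real n - 1)))"
      using i assms by (simp add: of_nat_diff)
    also have "\<dots> \<le> ?K * ?L ^ (d - 1) / real n"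
      using L assms by (cases "n = 1") auto
    finally show "(\<Sum>k\<in>{1..n}. ?c i k) \<le> (?K + 1) * ?L ^ (d - 1) / real n"
      by (simp add: algebra_simps add_divide_distrib)
  qed
  also have "\<dots> = (?K + 1) * ?L ^ (d - 1)"
    using assms by simp
  also have "\<dots> \<le> (?K + 1) * ?L ^ d"
    using L by (intro mult_left_mono power_increasing) auto
  finally show ?thesis by (simp add: add_ac)
qed

end

section \<open>Almost sure deviations\<close>

text \<open>The sandwich argument, stated for any nondecreasing sequence with these growth bounds so
  that records and broken records share it.\<close>

lemma (in prob_space) AE_monotone_deviation:
  fixes S :: "nat \<Rightarrow> 'a \<Rightarrow> real" and d :: nat and \<epsilon> C :: real
  assumes d: "d \<ge> 1" and eps: "\<epsilon> > 0" and C: "C \<ge> 0"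
    and int: "\<And>n. integrable M (S n)" "\<And>n. integrable M (\<lambda>\<omega>. (S n \<omega>)\<^sup>2)"
    and mono: "\<And>\<omega> n n'. \<omega> \<in> space M \<Longrightarrow> n \<le> n' \<Longrightarrow> S n \<omega> \<le> S n' \<omega>"
    and var: "\<And>n. n \<ge> 1 \<Longrightarrow> variance (S n) \<le> C * (1 + ln (real n)) ^ d"
    and incr: "\<And>n n'. 1 \<le> n \<Longrightarrow> n \<le> n' \<Longrightarrow>
      expectation (S n') - expectation (S n) \<le> C * (1 + ln (real n')) ^ (d - 1) * (ln (real n') - ln (real n))"
  shows "AE \<omega> in M. \<forall>\<^sub>F n in sequentially. \<bar>S n \<omega> - expectation (S n)\<bar> < ln (real n) powr (3 * real d / 4 + \<epsilon>)"
proof -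
  \<comment> \<open>Every n with \<open>t j \<le> ln n \<le> t (Suc j)\<close> lies between \<open>lo j\<close> and \<open>hi j\<close>, and \<open>t j ^ d = j\<^sup>2\<close>:
    the variance at these times is \<open>O(j^2)\<close>, the mean increment over a block \<open>O(j)\<close>.\<close>
  define t where "t j = real j powr (2 / real d)" for j
  define s where "s = 3 * real d / 4 + \<epsilon>"
  \<comment> \<open>Both ends are rounded into the block, so \<open>ln (hi j) - ln (lo j)\<close> is
    at most \<open>t (Suc j) - t j\<close> without rounding error; hence two sequences of
    times.\<close>
  define lo where "lo j = nat \<lceil>exp (t j)\<rceil>" for j
  define hi where "hi j = nat \<lfloor>exp (t (Suc j))\<rfloor>" for j
  define \<theta> where "\<theta> j = t j powr s" for j
  \<comment> \<open>The 4 comes from the halved threshold in Chebyshev's inequality, the 6 from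
    \<open>1 + ln n \<le> 6 * t j\<close> at both ends of a block.\<close>
  define K where "K = 4 * (C * 6 ^ d)"
  have \<theta>_eq: "\<theta> j = real j powr (3 / 2 + 2 * \<epsilon> / real d)" for j
  proof -
    have "2 / real d * s = 3 / 2 + 2 * \<epsilon> / real d" using d by (simp add: s_def field_simps)
    then show ?thesis by (simp add: \<theta>_def t_def powr_powr)
  qed
  have t_pow: "t j ^ d = (real j)\<^sup>2" if "j \<ge> 1" for j
    using d that by (simp add: t_def powr_power powr_realpow[of "real j" 2, simplified])
  have t_nonneg: "0 \<le> t j" for j by (simp add: t_def)
  have t_mono: "t i \<le> t j" if "i \<le> j" for i j
    using that by (simp add: t_def powr_mono2)
  have t_ge_1: "1 \<le> t j" if "j \<ge> 1" for j
    using that by (simp add: t_def ge_one_powr_ge_zero)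
  have t_Suc: "t (Suc j) \<le> 4 * t j" if "j \<ge> 1" for j
  proof -
    have "t (Suc j) \<le> (2 * real j) powr (2 / real d)"
      using that unfolding t_def by (intro powr_mono2) auto
    also have "\<dots> = 2 powr (2 / real d) * t j"
      by (simp add: t_def powr_mult)
    also have "\<dots> \<le> 2 powr 2 * t j"
      using d t_nonneg by (intro mult_right_mono powr_mono) (auto simp: field_simps)
    finally show ?thesis by simp
  qed
  have lo_ge: "exp (t j) \<le> real (lo j)" for j
    unfolding lo_def by (rule real_nat_ceiling_ge)
  have hi_le: "real (hi j) \<le> exp (t (Suc j))" for j
    unfolding hi_def by (intro of_nat_floor) simp
  have lo1: "1 \<le> lo j" for j
    unfolding lo_def using exp_gt_zero[of "t j"] by (simp add: nat_le_iff Suc_le_eq)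
  have hi1: "1 \<le> hi j" for j
  proof -
    have "1 \<le> exp (t (Suc j))" using t_nonneg by simp
    then show ?thesis unfolding hi_def by (simp add: le_nat_iff le_floor_iff)
  qed
  have ln_lo: "t j \<le> ln (real (lo j))" for j
    using lo_ge[of j] lo1[of j] by (subst ln_ge_iff) auto
  have ln_lo': "ln (real (lo j)) \<le> t j + 1" for j
  proof -
    have "real (lo j) \<le> exp (t j) + 1"
      unfolding lo_def using ceiling_correct[of "exp (t j)"] exp_gt_zero[of "t j"] by simp
    also have "\<dots> \<le> exp (t j) * 2" using t_nonneg[of j] by simp
    also have "\<dots> \<le> exp (t j) * exp 1"
      using exp_ge_add_one_self[of 1] by (intro mult_left_mono) auto
    finally have "ln (real (lo j)) \<le> ln (exp (t j + 1))"
      using lo1[of j] by (subst ln_le_cancel_iff) (auto simp: exp_add)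
    then show ?thesis by simp
  qed
  have ln_hi: "ln (real (hi j)) \<le> t (Suc j)" for j
  proof -
    have "ln (real (hi j)) \<le> ln (exp (t (Suc j)))"
      using hi1[of j] hi_le[of j] by (subst ln_le_cancel_iff) auto
    then show ?thesis by simp
  qed
  have prob_le: "prob {\<omega> \<in> space M. \<theta> j / 2 \<le> \<bar>S n \<omega> - expectation (S n)\<bar>} \<le> K * real j powr (- 1 - 4 * \<epsilon> / real d)"
    if j: "j \<ge> 1" and n: "n \<ge> 1" "1 + ln (real n) \<le> 6 * t j" for j n
  proof -
    have \<theta>: "\<theta> j > 0" using j by (simp add: \<theta>_eq)
    have "prob {\<omega> \<in> space M. \<theta> j / 2 \<le> \<bar>S n \<omega> - expectation (S n)\<bar>} \<le> variance (S n) / (\<theta> j / 2)\<^sup>2"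
      using int \<theta> by (intro Chebyshev_inequality) auto
    also have "\<dots> \<le> C * (6 * t j) ^ d / (\<theta> j / 2)\<^sup>2"
    proof (intro divide_right_mono order_trans[OF var[OF n(1)]] mult_left_mono power_mono n C)
      show "0 \<le> 1 + ln (real n)" using n by simp
    qed simp
    also have "\<dots> = K * ((real j)\<^sup>2 / (\<theta> j)\<^sup>2)"
      using t_pow[OF j] by (simp add: K_def power_mult_distrib power_divide)
    also have "(real j)\<^sup>2 = real j powr 2"
      using j powr_realpow[of "real j" 2] by simp
    also have "(\<theta> j)\<^sup>2 = real j powr (3 + 4 * \<epsilon> / real d)"
      using j by (simp add: \<theta>_eq powr_power algebra_simps)
    also have "real j powr 2 / real j powr (3 + 4 * \<epsilon> / real d) = real j powr (- 1 - 4 * \<epsilon> / real d)"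
      unfolding powr_diff[symmetric] by (rule arg_cong[where f = "(powr) (real j)"]) simp
    finally show ?thesis .
  qed
  have summ: "summable (\<lambda>j. K * real j powr (- 1 - 4 * \<epsilon> / real d))"
    using d eps by (intro summable_mult) (simp add: summable_real_powr_iff)
  have conc: "AE \<omega> in M. \<forall>\<^sub>F j in sequentially. \<bar>S (\<nu> j) \<omega> - expectation (S (\<nu> j))\<bar> < \<theta> j / 2"
    if \<nu>: "\<And>j. \<nu> j \<ge> 1" "\<And>j. j \<ge> 1 \<Longrightarrow> 1 + ln (real (\<nu> j)) \<le> 6 * t j" for \<nu>
  proof -
    let ?B = "\<lambda>j. {\<omega> \<in> space M. \<theta> j / 2 \<le> \<bar>S (\<nu> j) \<omega> - expectation (S (\<nu> j))\<bar>}"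
    have [measurable]: "S n \<in> borel_measurable M" for n
      using int(1) by auto
    have "AE \<omega> in M. \<forall>\<^sub>F j in sequentially. \<omega> \<in> space M - ?B j"
    proof (rule borel_cantelli_AE1)
      show "summable (\<lambda>j. prob (?B j))"
      proof (rule summable_comparison_test_ev[OF _ summ])
        show "\<forall>\<^sub>F j in sequentially. norm (prob (?B j)) \<le> K * real j powr (- 1 - 4 * \<epsilon> / real d)"
          using eventually_ge_at_top[of 1] by eventually_elim (simp only: real_norm_def abs_of_nonneg[OF measure_nonneg] prob_le \<nu>)
      qed
    qed (auto simp: emeasure_eq_measure)
    then show ?thesis
      by (rule AE_mp) (auto intro!: AE_I2 elim!: eventually_mono)
  qed
  have AE_lo: "AE \<omega> in M. \<forall>\<^sub>F j in sequentially. \<bar>S (lo j) \<omega> - expectation (S (lo j))\<bar> < \<theta> j / 2"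
  proof (rule conc[OF lo1])
    fix j :: nat assume "j \<ge> 1"
    with ln_lo'[of j] t_ge_1[of j] show "1 + ln (real (lo j)) \<le> 6 * t j" by linarith
  qed
  have AE_hi: "AE \<omega> in M. \<forall>\<^sub>F j in sequentially. \<bar>S (hi j) \<omega> - expectation (S (hi j))\<bar> < \<theta> j / 2"
  proof (rule conc[OF hi1])
    fix j :: nat assume "j \<ge> 1"
    with ln_hi[of j] t_Suc[of j] t_ge_1[of j] show "1 + ln (real (hi j)) \<le> 6 * t j" by linarith
  qed
  have gap: "expectation (S (hi j)) - expectation (S (lo j)) \<le> C * 2 ^ (d - 1) * 3 * real j"
    if j: "j \<ge> 1" and le: "lo j \<le> hi j" for j
  proof -
    have T: "1 \<le> t (Suc j)" "t j \<le> t (Suc j)" using t_ge_1[of "Suc j"] t_mono[of j "Suc j"] by auto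
    have "expectation (S (hi j)) - expectation (S (lo j))
        \<le> C * (1 + ln (real (hi j))) ^ (d - 1) * (ln (real (hi j)) - ln (real (lo j)))"
      by (rule incr[OF lo1 le])
    also have "\<dots> \<le> C * (2 * t (Suc j)) ^ (d - 1) * (t (Suc j) - t j)"
      using ln_hi[of j] ln_lo[of j] T hi1[of j] lo1[of j] le C
      by (intro mult_mono power_mono mult_nonneg_nonneg zero_le_power) auto
    also have "\<dots> = C * 2 ^ (d - 1) * ((t (Suc j) - t j) * t (Suc j) ^ (d - 1))"
      by (simp add: power_mult_distrib)
    \<comment> \<open>The increment is compared with a difference of d-th powers because these are
      exactly the squares of j + 1 and j.\<close>
    also have "\<dots> \<le> C * 2 ^ (d - 1) * (t (Suc j) ^ Suc (d - 1) - t j ^ Suc (d - 1))"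
      using C T t_nonneg by (intro mult_left_mono power_diff_ge) auto
    also have "t (Suc j) ^ Suc (d - 1) - t j ^ Suc (d - 1) = (real (Suc j))\<^sup>2 - (real j)\<^sup>2"
      using d t_pow[of "Suc j"] t_pow[OF j] by simp
    also have "\<dots> \<le> 3 * real j"
      using j by (simp add: power2_eq_square algebra_simps)
    finally show ?thesis using C by (simp add: mult_left_mono mult.assoc)
  qed
  have gap_ev: "\<forall>\<^sub>F j in sequentially. j \<ge> 1 \<and> (lo j \<le> hi j \<longrightarrow> expectation (S (hi j)) - expectation (S (lo j)) \<le> \<theta> j / 2)"
  proof -
    \<comment> \<open>A mean increment of order j falls below the threshold, of order at least
      \<open>j powr (3/2)\<close>, once sqrt j >= B.\<close>
    define B where "B = 2 * (C * 2 ^ (d - 1) * 3)"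
    show ?thesis
      using eventually_ge_at_top[of 1] eventually_ge_at_top[of "nat \<lceil>B\<^sup>2\<rceil>"]
    proof eventually_elim
      case (elim j)
      have "B\<^sup>2 \<le> real j" using elim(2) by linarith
      then have "B \<le> sqrt (real j)" by (simp add: real_le_rsqrt)
      then have "B * real j \<le> sqrt (real j) * real j" by (intro mult_right_mono) auto
      also have "\<dots> = real j powr (3 / 2)"
        using elim powr_add[of "real j" "1 / 2" 1] by (simp add: powr_half_sqrt)
      also have "\<dots> \<le> \<theta> j"
        unfolding \<theta>_eq using elim eps by (intro powr_mono) auto
      finally have "C * 2 ^ (d - 1) * 3 * real j \<le> \<theta> j / 2" by (simp add: B_def)
      with gap[of j] elim show ?case by auto
    qed
  qed
  have E_mono: "expectation (S n) \<le> expectation (S n')" if "n \<le> n'" for n n'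
    using int mono that by (intro integral_mono) auto
  show ?thesis
    using AE_lo AE_hi AE_space
  proof eventually_elim
    case (elim \<omega>)
    from eventually_conj[OF eventually_conj[OF elim(1,2)] gap_ev]
    obtain J where J: "\<And>j. j \<ge> J \<Longrightarrow> \<bar>S (lo j) \<omega> - expectation (S (lo j))\<bar> < \<theta> j / 2"
      "\<And>j. j \<ge> J \<Longrightarrow> \<bar>S (hi j) \<omega> - expectation (S (hi j))\<bar> < \<theta> j / 2"
      "\<And>j. j \<ge> J \<Longrightarrow> j \<ge> 1"
      "\<And>j. j \<ge> J \<Longrightarrow> lo j \<le> hi j \<Longrightarrow> expectation (S (hi j)) - expectation (S (lo j)) \<le> \<theta> j / 2"
      unfolding eventually_sequentially by blast
    show ?case
      using eventually_ge_at_top[of "lo J"] eventually_ge_at_top[of 1]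
    proof eventually_elim
      case (elim n)
      define l where "l = ln (real n)"
      have l: "0 \<le> l" "exp l = real n" using elim(2) by (auto simp: l_def)
      \<comment> \<open>Inverting t: this j is the block index with
        \<open>t j \<le> l \<le> t (Suc j)\<close>.\<close>
      define j where "j = nat \<lfloor>l powr (real d / 2)\<rfloor>"
      have inv: "(x powr (real d / 2)) powr (2 / real d) = x" "(x powr (2 / real d)) powr (real d / 2) = x"
        if "0 \<le> x" for x
        using that d by (auto simp: powr_powr)
      have jle: "real j \<le> l powr (real d / 2)"
        unfolding j_def by (intro of_nat_floor) simp
      have jgt: "l powr (real d / 2) < real (Suc j)"
        unfolding j_def using powr_ge_zero[of l "real d / 2"] by linarith
      have tj: "t j \<le> l"
        using powr_mono2[OF _ _ jle, of "2 / real d"] l inv by (simp add: t_def)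
      have tSj: "l \<le> t (Suc j)"
        using powr_mono2[of "2 / real d" "l powr (real d / 2)" "real (Suc j)"] jgt l inv by (simp add: t_def)
      have "t J \<le> l"
      proof -
        have "exp (t J) \<le> exp l" using lo_ge[of J] elim(1) l by simp
        then show ?thesis by simp
      qed
      then have "t J powr (real d / 2) \<le> l powr (real d / 2)"
        using t_nonneg by (intro powr_mono2) auto
      then have "real J \<le> l powr (real d / 2)" by (simp add: t_def inv)
      with jgt have "real J < real (Suc j)" by linarith
      then have jJ: "J \<le> j" by simp
      have "exp (t j) \<le> real n" using tj l by (metis exp_le_cancel_iff)
      then have lon: "lo j \<le> n" unfolding lo_def by (simp add: nat_le_iff ceiling_le_iff)
      have "real n \<le> exp (t (Suc j))" using tSj l by (metis exp_le_cancel_iff)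
      then have nhi: "n \<le> hi j" unfolding hi_def by (simp add: le_nat_iff le_floor_iff)
      have "expectation (S (hi j)) - expectation (S (lo j)) \<le> \<theta> j / 2"
        using J(4)[OF jJ] lon nhi by simp
      \<comment> \<open>By monotonicity the error at n is at most the deviation at an endpoint plus
        the mean increment over the block, each contributing \<open>\<theta> j / 2\<close>.\<close>
      then have "\<bar>S n \<omega> - expectation (S n)\<bar> < \<theta> j"
        using J(1,2)[OF jJ] mono[OF \<open>\<omega> \<in> space M\<close> lon] mono[OF \<open>\<omega> \<in> space M\<close> nhi]
          E_mono[OF lon] E_mono[OF nhi] by linarith
      also have "\<theta> j \<le> l powr s"
        unfolding \<theta>_def using tj t_nonneg d eps by (intro powr_mono2) (auto simp: s_def)
      finally show ?case by (simp add: l_def s_def)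
    qed
  qed
qed

section \<open>From deviation bounds to null sets and ratios\<close>

lemma filterlim_ln_real: "filterlim (\<lambda>n. ln (real n)) at_top sequentially"
  using filterlim_compose[OF ln_at_top filterlim_real_sequentially] .

lemma ratio_tendsto_1:
  fixes S E :: "nat \<Rightarrow> real"
  assumes dev: "\<forall>\<^sub>F n in sequentially. \<bar>S n - E n\<bar> < ln (real n) powr s"
    and low: "\<forall>\<^sub>F n in sequentially. c * ln (real n) powr s' \<le> E n" and c: "c > 0" and s: "s < s'"
  shows "(\<lambda>n. S n / E n) \<longlonglongrightarrow> 1"
proof -
  have "(\<lambda>n. 1 / c * ln (real n) powr (s - s')) \<longlonglongrightarrow> 1 / c * 0"
    using s filterlim_ln_real by (intro tendsto_mult_left tendsto_neg_powr) auto
  then have lim: "(\<lambda>n. 1 / c * ln (real n) powr (s - s')) \<longlonglongrightarrow> 0" by simp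
  have "(\<lambda>n. S n / E n - 1) \<longlonglongrightarrow> 0"
  proof (rule Lim_null_comparison[OF _ lim])
    show "\<forall>\<^sub>F n in sequentially. norm (S n / E n - 1) \<le> 1 / c * ln (real n) powr (s - s')"
      using dev low eventually_gt_at_top[of 1]
    proof eventually_elim
      case (elim n)
      have pos: "0 < c * ln (real n) powr s'" using elim(3) c by simp
      with elim have E: "0 < E n" by linarith
      then have "norm (S n / E n - 1) = \<bar>S n - E n\<bar> / E n"
        by (simp add: diff_divide_distrib[symmetric] abs_divide field_simps)
      also have "\<dots> \<le> ln (real n) powr s / (c * ln (real n) powr s')"
        using elim pos by (intro frac_le) auto
      also have "\<dots> = 1 / c * ln (real n) powr (s - s')"
        by (simp add: powr_diff)
      finally show ?case .
    qed
  qed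
  then show ?thesis by (simp add: LIM_zero_iff)
qed

text \<open>Written with countable quantifiers the exceptional set is measurable, which turns the
  almost sure statement into membership in \<open>null_sets M\<close>.\<close>

lemma (in prob_space) null_set_frequently_deviation:
  fixes S :: "nat \<Rightarrow> 'a \<Rightarrow> real"
  assumes [measurable]: "\<And>n. S n \<in> borel_measurable M"
    and AE: "AE \<omega> in M. \<forall>\<^sub>F n in sequentially. \<bar>S n \<omega> - e n\<bar> < g n"
  shows "{\<omega> \<in> space M. \<exists>\<^sub>F n in sequentially. g n \<le> \<bar>S n \<omega> - e n\<bar>} \<in> null_sets M"
proof -
  have eq: "{\<omega> \<in> space M. \<exists>\<^sub>F n in sequentially. g n \<le> \<bar>S n \<omega> - e n\<bar>}
      = {\<omega> \<in> space M. \<not> (\<exists>N. \<forall>n\<ge>N. \<bar>S n \<omega> - e n\<bar> < g n)}"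
    by (auto simp: frequently_def eventually_sequentially not_le)
  have "{\<omega> \<in> space M. \<not> (\<exists>N. \<forall>n\<ge>N. \<bar>S n \<omega> - e n\<bar> < g n)} \<in> sets M"
    by measurable
  then show ?thesis
    unfolding eq using AE unfolding eventually_sequentially by (subst (asm) AE_iff_null) auto
qed

lemma sum_iter_mean_lower_powr:
  "\<forall>\<^sub>F n in sequentially. 1 / fact k * ln (real n) powr real k \<le> (\<Sum>i<n. iter_mean k i)"
  using eventually_gt_at_top[of 1]
proof eventually_elim
  case (elim n)
  have "ln (real n) ^ k \<le> ln (real n + 1) ^ k"
    using elim by (intro power_mono) auto
  then have "ln (real n) ^ k / fact k \<le> ln (real n + 1) ^ k / fact k"
    by (intro divide_right_mono) auto
  also have "\<dots> \<le> (\<Sum>i<n. iter_mean k i)"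
    using elim by (intro sum_iter_mean_lower) auto
  finally show ?case using elim by (simp add: powr_realpow)
qed

lemma (in prob_space) integrable_bounded:
  assumes "X \<in> borel_measurable M" "\<And>\<omega>. \<omega> \<in> space M \<Longrightarrow> \<bar>X \<omega>\<bar> \<le> B"
  shows "integrable M X" "integrable M (\<lambda>\<omega>. (X \<omega>)\<^sup>2 :: real)"
proof -
  note [measurable] = assms(1)
  show "integrable M X" using assms(2) by (intro integrable_const_bound[where B = B]) auto
  have "\<bar>X \<omega>\<bar>\<^sup>2 \<le> B\<^sup>2" if "\<omega> \<in> space M" for \<omega>
    using assms(2)[OF that] by (intro power_mono) auto
  then show "integrable M (\<lambda>\<omega>. (X \<omega>)\<^sup>2)"
    by (intro integrable_const_bound[where B = "B\<^sup>2"]) auto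
qed

text \<open>From (u - v)^2 <= 2 u^2 + 2 v^2 for the centred variables; the covariance of records and
  current records need not be estimated.\<close>

lemma (in prob_space) variance_diff_le:
  fixes X Z :: "'a \<Rightarrow> real"
  assumes [measurable]: "X \<in> borel_measurable M" "Z \<in> borel_measurable M"
    and X: "\<And>\<omega>. \<omega> \<in> space M \<Longrightarrow> \<bar>X \<omega>\<bar> \<le> B" and Z: "\<And>\<omega>. \<omega> \<in> space M \<Longrightarrow> \<bar>Z \<omega>\<bar> \<le> B"
  shows "variance (\<lambda>\<omega>. X \<omega> - Z \<omega>) \<le> 2 * variance X + 2 * variance Z"
proof -
  have int: "integrable M X" "integrable M Z"
    using X Z by (auto intro!: integrable_const_bound[where B = B])
  have sq: "integrable M (\<lambda>\<omega>. (W \<omega> - c)\<^sup>2)"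
    if [measurable]: "W \<in> borel_measurable M" and W: "\<And>\<omega>. \<omega> \<in> space M \<Longrightarrow> \<bar>W \<omega>\<bar> \<le> D" for W :: "'a \<Rightarrow> real" and c D :: real
  proof (rule integrable_const_bound[where B = "(D + \<bar>c\<bar>)\<^sup>2"])
    show "AE \<omega> in M. norm ((W \<omega> - c)\<^sup>2) \<le> (D + \<bar>c\<bar>)\<^sup>2"
    proof (rule AE_I2)
      fix \<omega> assume "\<omega> \<in> space M"
      from W[OF this] have "\<bar>W \<omega> - c\<bar> \<le> \<bar>D + \<bar>c\<bar>\<bar>" by linarith
      then show "norm ((W \<omega> - c)\<^sup>2) \<le> (D + \<bar>c\<bar>)\<^sup>2" by (simp add: abs_le_square_iff)
    qed
  qed simp
  have sqX: "integrable M (\<lambda>\<omega>. (X \<omega> - expectation X)\<^sup>2)" and sqZ: "integrable M (\<lambda>\<omega>. (Z \<omega> - expectation Z)\<^sup>2)"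
    by (rule sq[OF _ X], simp_all, rule sq[OF _ Z], simp_all)
  have XZ: "\<bar>X \<omega> - Z \<omega>\<bar> \<le> 2 * B" if "\<omega> \<in> space M" for \<omega>
    using X[OF that] Z[OF that] by linarith
  have "variance (\<lambda>\<omega>. X \<omega> - Z \<omega>)
      \<le> expectation (\<lambda>\<omega>. 2 * (X \<omega> - expectation X)\<^sup>2 + 2 * (Z \<omega> - expectation Z)\<^sup>2)"
  proof (intro integral_mono Bochner_Integration.integrable_add integrable_mult_right sqX sqZ)
    show "integrable M (\<lambda>\<omega>. (X \<omega> - Z \<omega> - expectation (\<lambda>\<omega>. X \<omega> - Z \<omega>))\<^sup>2)"
      by (rule sq[OF _ XZ]) simp_all
    fix \<omega>
    define u v where "u = X \<omega> - expectation X" and "v = Z \<omega> - expectation Z"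
    have "X \<omega> - Z \<omega> - expectation (\<lambda>\<omega>. X \<omega> - Z \<omega>) = u - v"
      using int by (simp add: u_def v_def)
    moreover have "(u - v)\<^sup>2 \<le> 2 * u\<^sup>2 + 2 * v\<^sup>2"
      using zero_le_power2[of "u + v"] by (simp add: power2_eq_square algebra_simps)
    ultimately show "(X \<omega> - Z \<omega> - expectation (\<lambda>\<omega>. X \<omega> - Z \<omega>))\<^sup>2
        \<le> 2 * (X \<omega> - expectation X)\<^sup>2 + 2 * (Z \<omega> - expectation Z)\<^sup>2"
      by (simp only: u_def v_def)
  qed
  also have "\<dots> = 2 * variance X + 2 * variance Z"
    using sqX sqZ by simp
  finally show ?thesis .
qed

section \<open>Deviations and ratios of records, broken records and current records\<close>

context iid_exponentials
begin

definition broken :: "nat \<Rightarrow> 'a \<Rightarrow> real" where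
  "broken n \<omega> = records n \<omega> - currents n \<omega>"

lemma records_measurable [measurable]: "records n \<in> borel_measurable M"
proof -
  have "(\<lambda>\<omega>. \<Sum>m<n. indicator (record_event (Suc m)) \<omega> :: real) \<in> borel_measurable M"
    by (intro borel_measurable_sum borel_measurable_indicator record_event_measurable) simp
  then show ?thesis by (rule measurable_cong[THEN iffD1, rotated]) (simp add: records_eq)
qed

lemma currents_measurable [measurable]: "currents n \<in> borel_measurable M"
proof -
  have "(\<lambda>\<omega>. \<Sum>k\<in>{1..n}. indicator (current_event n k) \<omega> :: real) \<in> borel_measurable M"
    by (intro borel_measurable_sum borel_measurable_indicator current_event_measurable) simp
  then show ?thesis by (rule measurable_cong[THEN iffD1, rotated]) (simp add: currents_eq)
qed

lemma broken_measurable [measurable]: "broken n \<in> borel_measurable M"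
  unfolding broken_def[abs_def] by measurable

lemma records_bounded: "\<bar>records n \<omega>\<bar> \<le> real n"
  unfolding records_def num_records_def using card_mono[of "{1..n}"] by (simp add: subset_eq)

lemma currents_bounded: "\<bar>currents n \<omega>\<bar> \<le> real n"
  unfolding currents_def num_current_records_def using card_mono[of "{1..n}"] by (simp add: subset_eq)

lemma records_mono:
  assumes "\<omega> \<in> space M" "n \<le> n'"
  shows "records n \<omega> \<le> records n' \<omega>"
  unfolding records_eq[OF assms(1)] using assms(2) by (intro sum_mono2) auto

text \<open>Observation k contributes 1 when it was a record and has been broken by time n. Each
  \<open>current_event n k\<close> shrinks as n grows, and terms with new indices are nonnegative
  because a current record is a record.\<close>

lemma broken_mono:
  assumes "\<omega> \<in> space M" "n \<le> n'"
  shows "broken n \<omega> \<le> broken n' \<omega>"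
proof -
  have eq: "broken n \<omega> = (\<Sum>k\<in>{1..n}. indicator (record_event k) \<omega> - indicator (current_event n k) \<omega>)" for n
  proof -
    have "(\<Sum>m<n. indicator (record_event (Suc m)) \<omega> :: real) = (\<Sum>k\<in>{1..n}. indicator (record_event k) \<omega>)"
      by (rule sum.reindex_bij_witness[of _ "\<lambda>k. k - 1" Suc]) auto
    then show ?thesis
      by (simp add: broken_def records_eq[OF assms(1)] currents_eq[OF assms(1)] sum_subtractf)
  qed
  have "broken n \<omega> \<le> (\<Sum>k\<in>{1..n}. indicator (record_event k) \<omega> - indicator (current_event n' k) \<omega>)"
    unfolding eq using assms
    by (intro sum_mono diff_left_mono) (auto simp: current_event_def indicator_def)
  also have "\<dots> \<le> broken n' \<omega>"
    unfolding eq using assms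
    by (intro sum_mono2) (auto simp: current_event_def record_event_def indicator_def)
  finally show ?thesis .
qed

lemma broken_bounded: "\<bar>broken n \<omega>\<bar> \<le> 2 * real n"
  using records_bounded[of n \<omega>] currents_bounded[of n \<omega>] by (simp add: broken_def)

lemma expectation_broken: "expectation (broken n) = expectation (records n) - expectation (currents n)"
  unfolding broken_def
  by (intro Bochner_Integration.integral_diff integrable_bounded[where B = "real n"])
    (auto simp: records_bounded currents_bounded)

lemma expectation_records_incr:
  assumes "1 \<le> n" "n \<le> n'"
  shows "expectation (records n') - expectation (records n)
    \<le> (1 + ln (real n')) ^ (d - 1) * (ln (real n') - ln (real n))"
  unfolding expectation_records using sum_iter_mean_incr[OF assms, of "d - 1"] dim_pos by simp

lemma expectation_currents_mono: "n \<le> n' \<Longrightarrow> expectation (currents n) \<le> expectation (currents n')"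
  unfolding expectation_currents by (intro sum_mono2) (auto simp: iter_mean_nonneg)

lemma AE_records_deviation:
  assumes "\<epsilon> > 0"
  shows "AE \<omega> in M. \<forall>\<^sub>F n in sequentially.
    \<bar>records n \<omega> - expectation (records n)\<bar> < ln (real n) powr (3 * real d / 4 + \<epsilon>)"
proof (rule AE_monotone_deviation[OF dim_pos assms, where C = "3 + 128 * 8 ^ d"])
  fix n n' :: nat assume n: "1 \<le> n" "n \<le> n'"
  have "expectation (records n') - expectation (records n)
      \<le> 1 * ((1 + ln (real n')) ^ (d - 1) * (ln (real n') - ln (real n)))"
    using expectation_records_incr[OF n] by simp
  also have "\<dots> \<le> (3 + 128 * 8 ^ d) * ((1 + ln (real n')) ^ (d - 1) * (ln (real n') - ln (real n)))"
    using n by (intro mult_right_mono mult_nonneg_nonneg zero_le_power) auto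
  finally show "expectation (records n') - expectation (records n)
      \<le> (3 + 128 * 8 ^ d) * (1 + ln (real n')) ^ (d - 1) * (ln (real n') - ln (real n))"
    by (simp add: mult.assoc)
qed (auto intro!: integrable_bounded[OF records_measurable records_bounded] records_mono variance_records)

text \<open>The mean of the broken records grows no faster than that of the records, since the mean
  of the current records is nondecreasing. The constant is 2 (3 + 128 * 8^d) + 2 (5 + 1536 *
  8^d).\<close>

lemma AE_broken_deviation:
  assumes "\<epsilon> > 0"
  shows "AE \<omega> in M. \<forall>\<^sub>F n in sequentially.
    \<bar>broken n \<omega> - expectation (broken n)\<bar> < ln (real n) powr (3 * real d / 4 + \<epsilon>)"
proof (rule AE_monotone_deviation[OF dim_pos assms, where C = "16 + 3328 * 8 ^ d"])
  fix n :: nat assume n: "n \<ge> 1"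
  have "variance (broken n) \<le> 2 * variance (records n) + 2 * variance (currents n)"
    unfolding broken_def by (rule variance_diff_le[where B = "real n"]) (auto simp: records_bounded currents_bounded)
  also have "\<dots> \<le> 2 * ((3 + 128 * 8 ^ d) * (1 + ln (real n)) ^ d) + 2 * ((5 + 1536 * 8 ^ d) * (1 + ln (real n)) ^ d)"
    using n by (intro add_mono mult_left_mono variance_records variance_currents) auto
  also have "\<dots> = (16 + 3328 * 8 ^ d) * (1 + ln (real n)) ^ d"
    by (simp add: algebra_simps)
  finally show "variance (broken n) \<le> (16 + 3328 * 8 ^ d) * (1 + ln (real n)) ^ d" .
next
  fix n n' :: nat assume n: "1 \<le> n" "n \<le> n'"
  have "expectation (broken n') - expectation (broken n)
      \<le> 1 * ((1 + ln (real n')) ^ (d - 1) * (ln (real n') - ln (real n)))"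
    using expectation_records_incr[OF n] expectation_currents_mono[OF n(2)] by (simp add: expectation_broken)
  also have "\<dots> \<le> (16 + 3328 * 8 ^ d) * ((1 + ln (real n')) ^ (d - 1) * (ln (real n') - ln (real n)))"
    using n by (intro mult_right_mono mult_nonneg_nonneg zero_le_power) auto
  finally show "expectation (broken n') - expectation (broken n)
      \<le> (16 + 3328 * 8 ^ d) * (1 + ln (real n')) ^ (d - 1) * (ln (real n') - ln (real n))"
    by (simp add: mult.assoc)
qed (auto intro!: integrable_bounded[OF broken_measurable broken_bounded] broken_mono)

text \<open>Both deviation bounds are used with half of the given exponent surplus; the other half
  absorbs the factor 2 of the triangle inequality once \<open>ln n\<close> is large.\<close>

lemma AE_currents_deviation:
  assumes eps: "\<epsilon> > 0"
  shows "AE \<omega> in M. \<forall>\<^sub>F n in sequentially.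
    \<bar>currents n \<omega> - expectation (currents n)\<bar> < ln (real n) powr (3 * real d / 4 + \<epsilon>)"
proof -
  let ?e = "3 * real d / 4 + \<epsilon> / 2"
  have large: "\<forall>\<^sub>F n in sequentially. 2 powr (2 / \<epsilon>) \<le> ln (real n)"
    using filterlim_ln_real by (simp add: filterlim_at_top)
  have pow: "2 * l powr ?e \<le> l powr (3 * real d / 4 + \<epsilon>)" if "2 powr (2 / \<epsilon>) \<le> l" for l :: real
  proof -
    have "2 = (2 powr (2 / \<epsilon>)) powr (\<epsilon> / 2)" using eps by (simp add: powr_powr)
    also have "\<dots> \<le> l powr (\<epsilon> / 2)" using that eps by (intro powr_mono2) auto
    finally have "2 * l powr ?e \<le> l powr (\<epsilon> / 2) * l powr ?e" by (intro mult_right_mono) auto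
    also have "\<dots> = l powr (3 * real d / 4 + \<epsilon>)" by (simp flip: powr_add add: field_simps)
    finally show ?thesis .
  qed
  show ?thesis
    using AE_records_deviation[OF half_gt_zero[OF eps]] AE_broken_deviation[OF half_gt_zero[OF eps]]
  proof eventually_elim
    case (elim \<omega>)
    from elim(1,2) large show ?case
    proof eventually_elim
      case (elim n)
      have "currents n \<omega> - expectation (currents n)
          = (records n \<omega> - expectation (records n)) - (broken n \<omega> - expectation (broken n))"
        by (simp add: expectation_broken) (simp add: broken_def)
      then have "\<bar>currents n \<omega> - expectation (currents n)\<bar> < 2 * ln (real n) powr ?e"
        using elim(1,2) by linarith
      also have "\<dots> \<le> ln (real n) powr (3 * real d / 4 + \<epsilon>)"
        by (rule pow[OF elim(3)])
      finally show ?case .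
    qed
  qed
qed

text \<open>The mean of the current records has one logarithm less, so it is at most half of the
  lower bound for the records once \<open>ln n\<close> reaches
  \<open>2 ^ d * fact d\<close>.\<close>

lemma expectation_broken_lower:
  "\<forall>\<^sub>F n in sequentially. 1 / (2 * fact d) * ln (real n) powr real d \<le> expectation (broken n)"
proof -
  have "\<forall>\<^sub>F n in sequentially. max 1 (2 ^ d * fact d) \<le> ln (real n)"
    using filterlim_ln_real unfolding filterlim_at_top by blast
  then show ?thesis
    using sum_iter_mean_lower_powr[of d] eventually_gt_at_top[of 1]
  proof eventually_elim
    case (elim n)
    define l where "l = ln (real n)"
    have l: "1 \<le> l" "2 ^ d * fact d \<le> l" using elim by (auto simp: l_def)
    have dd: "2 * (2::real) ^ (d - 1) = 2 ^ d" "l * l ^ (d - 1) = l ^ d"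
      using dim_pos by (cases d; simp)+
    have "expectation (currents n) \<le> (1 + l) ^ (d - 1)"
      unfolding expectation_currents l_def using elim by (intro sum_iter_mean_upper) auto
    also have "\<dots> \<le> (2 * l) ^ (d - 1)"
      using l by (intro power_mono) auto
    also have "\<dots> = (2 ^ d * fact d) * l ^ (d - 1) / (2 * fact d)"
      by (simp add: power_mult_distrib flip: dd)
    also have "\<dots> \<le> l * l ^ (d - 1) / (2 * fact d)"
      using l by (intro divide_right_mono mult_right_mono) auto
    also have "\<dots> = 1 / (2 * fact d) * l powr real d"
      using l dd by (simp add: powr_realpow)
    finally have "expectation (currents n) \<le> 1 / (2 * fact d) * l powr real d" .
    moreover have "1 / fact d * l powr real d \<le> expectation (records n)"
      using elim by (simp add: expectation_records l_def)
    moreover have "1 / fact d * l powr real d = 2 * (1 / (2 * fact d) * l powr real d)" by simp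
    ultimately show ?case unfolding expectation_broken l_def by linarith
  qed
qed

text \<open>The surplus 1/8 keeps 3d/4 + 1/8 below d for every d >= 1.\<close>

lemma AE_records_ratio: "AE \<omega> in M. (\<lambda>n. records n \<omega> / expectation (records n)) \<longlonglongrightarrow> 1"
proof -
  have "(1 / 8 :: real) > 0" by simp
  from AE_records_deviation[OF this] show ?thesis
  proof eventually_elim
    case (elim \<omega>)
    from elim show ?case
      by (rule ratio_tendsto_1[where c = "1 / fact d" and s' = "real d"])
        (use sum_iter_mean_lower_powr[of d] dim_pos in \<open>auto simp: expectation_records\<close>)
  qed
qed

lemma AE_broken_ratio: "AE \<omega> in M. (\<lambda>n. broken n \<omega> / expectation (broken n)) \<longlonglongrightarrow> 1"
proof -
  have "(1 / 8 :: real) > 0" by simp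
  from AE_broken_deviation[OF this] show ?thesis
  proof eventually_elim
    case (elim \<omega>)
    from elim expectation_broken_lower show ?case
      by (rule ratio_tendsto_1) (use dim_pos in auto)
  qed
qed

text \<open>The mean has order \<open>(ln n)^(d-1)\<close>, and 3d/4 + 1/8 < d - 1 holds from d = 5
  on.\<close>

lemma AE_currents_ratio:
  assumes "d \<ge> 5"
  shows "AE \<omega> in M. (\<lambda>n. currents n \<omega> / expectation (currents n)) \<longlonglongrightarrow> 1"
proof -
  have "(1 / 8 :: real) > 0" by simp
  from AE_currents_deviation[OF this] show ?thesis
  proof eventually_elim
    case (elim \<omega>)
    from elim show ?case
      by (rule ratio_tendsto_1[where c = "1 / fact (d - 1)" and s' = "real (d - 1)"])
        (use sum_iter_mean_lower_powr[of "d - 1"] assms in \<open>auto simp: expectation_currents of_nat_diff\<close>)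
  qed
qed

end

theorem theorem4p2:
  fixes M :: "'a measure" and Y :: "nat \<Rightarrow> nat \<Rightarrow> 'a \<Rightarrow> real"
    and d :: nat and \<epsilon> :: real
  assumes "prob_space M"
    and "d \<ge> 1" and "\<epsilon> > 0"
    and indep: "prob_space.indep_vars M (\<lambda>_. borel) (\<lambda>(k, j). Y k j) ({1..} \<times> {..<d})"
    and expo: "\<And>k j. k \<ge> 1 \<Longrightarrow> j < d \<Longrightarrow> distributed M lborel (Y k j) (exponential_density 1)"
  defines "R \<equiv> \<lambda>n \<omega>. real (num_records d (\<lambda>k j. Y k j \<omega>) n)"
    and "r \<equiv> \<lambda>n \<omega>. real (num_current_records d (\<lambda>k j. Y k j \<omega>) n)"
    and "\<beta> \<equiv> \<lambda>n \<omega>. num_broken_records d (\<lambda>k j. Y k j \<omega>) n"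
  shows
    "{\<omega> \<in> space M. \<exists>\<^sub>F n in sequentially.
        \<bar>R n \<omega> - prob_space.expectation M (R n)\<bar> \<ge> ln (real n) powr (3 * real d / 4 + \<epsilon>)} \<in> null_sets M
     \<and> (AE \<omega> in M. (\<lambda>n. R n \<omega> / prob_space.expectation M (R n)) \<longlonglongrightarrow> 1)
     \<and> {\<omega> \<in> space M. \<exists>\<^sub>F n in sequentially.
        \<bar>\<beta> n \<omega> - prob_space.expectation M (\<beta> n)\<bar> \<ge> ln (real n) powr (3 * real d / 4 + \<epsilon>)} \<in> null_sets M
     \<and> (AE \<omega> in M. (\<lambda>n. \<beta> n \<omega> / prob_space.expectation M (\<beta> n)) \<longlonglongrightarrow> 1)
     \<and> {\<omega> \<in> space M. \<exists>\<^sub>F n in sequentially.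
        \<bar>r n \<omega> - prob_space.expectation M (r n)\<bar> \<ge> ln (real n) powr (3 * real d / 4 + \<epsilon>)} \<in> null_sets M
     \<and> (d \<ge> 5 \<longrightarrow> (AE \<omega> in M. (\<lambda>n. r n \<omega> / prob_space.expectation M (r n)) \<longlonglongrightarrow> 1))"
proof -
  interpret iid_exponentials M Y d
    using assms by (auto simp: iid_exponentials_def iid_exponentials_axioms_def)
  have R: "R = records" and r: "r = currents" and \<beta>: "\<beta> = broken"
    unfolding R_def r_def \<beta>_def
    by (auto simp: fun_eq_iff records_def currents_def broken_def num_broken_records_def)
  show ?thesis
    unfolding R r \<beta>
    using \<open>\<epsilon> > 0\<close>
    by (intro conjI impI null_set_frequently_deviation AE_records_deviation AE_broken_deviation
        AE_currents_deviation AE_records_ratio AE_broken_ratio AE_currents_ratio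
        records_measurable broken_measurable currents_measurable)
qed

end
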